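(* Let $R$ be a local fqp-ring. Then $\lambda\text{-}\dim(R)\leq 2$.
   Context: All rings are commutative with unity. A local ring is a ring with exactly one maximal ideal (no Noetherian assumption). An $R$-module $V$ is quasi-projective if the natural homomorphism $\mathrm{Hom}_R(V,V)\rightarrow\mathrm{Hom}_R(V,V/X)$ is surjective for every submodule $X$ of $V$. $R$ is an fqp-ring if every finitely generated ideal of $R$ is quasi-projective. An $R$-module $E$ is of finite $n$-presentation if there is an exact sequence $F_n\rightarrow F_{n-1}\rightarrow\cdots\rightarrow F_1\rightarrow F_0\rightarrow E\rightarrow 0$ with all $F_i$ free $R$-modules of finite rank. Put $\lambda_R(E)=\sup\{n\mid \text{there is a finite } n\text{-presentation of } E\}$, and $\lambda_R(E)=-1$ if $E$ is not finitely generated. The $\lambda$-dimension $\lambda\text{-}\dim(R)$ is the least integer $n$ (or $\infty$ if none exists) such that, for every $R$-module $E$, $\lambda_R(E)\geq n$ implies $\lambda_R(E)=\infty$. *)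

theory Defs
  imports "HOL-Algebra.Algebra" "HOL-Library.Extended_Real"
begin

definition local_ring :: "('a, 'r) ring_scheme \<Rightarrow> bool" where
  "local_ring R \<longleftrightarrow> cring R \<and> (\<exists>!M. maximalideal M R)"

text \<open>Modules are the records of \<^theory>\<open>HOL-Algebra.Module\<close>. Such a record extends the ring
  record; its multiplication and one play no role in the notion of a module, so their
  values below do not matter.\<close>

definition module_hom ::
  "('a, 'r) ring_scheme \<Rightarrow> ('a, 'm) module \<Rightarrow> ('a, 'n) module \<Rightarrow> ('m \<Rightarrow> 'n) set" where
  "module_hom R V W = {f \<in> carrier V \<rightarrow> carrier W.
     (\<forall>x\<in>carrier V. \<forall>y\<in>carrier V. f (x \<oplus>\<^bsub>V\<^esub> y) = f x \<oplus>\<^bsub>W\<^esub> f y) \<and>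
     (\<forall>r\<in>carrier R. \<forall>x\<in>carrier V. f (r \<odot>\<^bsub>V\<^esub> x) = r \<odot>\<^bsub>W\<^esub> f x)}"

text \<open>The quotient \<open>V/U\<close>, whose elements are the cosets \<open>U + v\<close>. For a submodule \<open>U\<close> the union in
  the scalar multiplication is the single coset \<open>U + r v\<close>, for any representative \<open>v\<close> of the
  coset \<open>A\<close>.\<close>

definition quot_module :: "('a, 'm) module \<Rightarrow> 'm set \<Rightarrow> ('a, 'm set) module" where
  "quot_module V U = \<lparr>carrier = a_rcosets\<^bsub>V\<^esub> U, monoid.mult = (\<lambda>_ _. U), monoid.one = U, ring.zero = U,
     ring.add = (<+>\<^bsub>V\<^esub>), smult = (\<lambda>r A. \<Union>v\<in>A. U +>\<^bsub>V\<^esub> (r \<odot>\<^bsub>V\<^esub> v))\<rparr>"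

definition quasi_projective :: "('a, 'r) ring_scheme \<Rightarrow> ('a, 'm) module \<Rightarrow> bool" where
  "quasi_projective R V \<longleftrightarrow> module R V \<and>
     (\<forall>U. submodule U R V \<longrightarrow>
       (\<forall>g\<in>module_hom R V (quot_module V U). \<exists>f\<in>module_hom R V V.
          \<forall>v\<in>carrier V. g v = U +>\<^bsub>V\<^esub> f v))"

definition ideal_module :: "('a, 'r) ring_scheme \<Rightarrow> 'a set \<Rightarrow> ('a, 'a) module" where
  "ideal_module R I = \<lparr>carrier = I, monoid.mult = (\<otimes>\<^bsub>R\<^esub>), monoid.one = \<one>\<^bsub>R\<^esub>, ring.zero = \<zero>\<^bsub>R\<^esub>,
     ring.add = (\<oplus>\<^bsub>R\<^esub>), smult = (\<otimes>\<^bsub>R\<^esub>)\<rparr>"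

definition fqp_ring :: "('a, 'r) ring_scheme \<Rightarrow> bool" where
  "fqp_ring R \<longleftrightarrow> cring R \<and>
     (\<forall>S. finite S \<and> S \<subseteq> carrier R \<longrightarrow> quasi_projective R (ideal_module R (Idl\<^bsub>R\<^esub> S)))"

definition fg_module :: "('a, 'r) ring_scheme \<Rightarrow> ('a, 'm) module \<Rightarrow> bool" where
  "fg_module R M \<longleftrightarrow> module R M \<and> (\<exists>B. finite B \<and> B \<subseteq> carrier M \<and>
     (\<forall>v\<in>carrier M. \<exists>c\<in>B \<rightarrow> carrier R. v = (\<Oplus>\<^bsub>M\<^esub>b\<in>B. c b \<odot>\<^bsub>M\<^esub> b)))"

text \<open>\<open>B\<close> is a finite basis. The coefficient families are extensional, since otherwise they could
  not be unique: functions are total and may take any value outside \<open>B\<close>.\<close>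

definition free_module_of_finite_rank :: "('a, 'r) ring_scheme \<Rightarrow> ('a, 'm) module \<Rightarrow> bool" where
  "free_module_of_finite_rank R M \<longleftrightarrow> module R M \<and> (\<exists>B. finite B \<and> B \<subseteq> carrier M \<and>
     (\<forall>v\<in>carrier M. \<exists>!c. c \<in> B \<rightarrow>\<^sub>E carrier R \<and> v = (\<Oplus>\<^bsub>M\<^esub>b\<in>B. c b \<odot>\<^bsub>M\<^esub> b)))"

text \<open>An exact sequence \<open>F\<^sub>n \<rightarrow> \<dots> \<rightarrow> F\<^sub>1 \<rightarrow> F\<^sub>0 \<rightarrow> E \<rightarrow> 0\<close>, where \<open>d i\<close> maps \<open>F\<^sub>i\<^sub>+\<^sub>1\<close> to \<open>F\<^sub>i\<close> and \<open>e\<close> maps \<open>F\<^sub>0\<close>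
  to \<open>E\<close>; exactness is not required at \<open>F\<^sub>n\<close>. An existential quantifier cannot range over types,
  so the \<open>F\<^sub>i\<close> live on the type \<open>nat \<Rightarrow> 'a\<close>. This loses nothing: a copy of \<open>R\<^sup>k\<close>, hence of every
  free module of finite rank, lives on that type.\<close>

definition finite_n_presentation ::
  "('a, 'r) ring_scheme \<Rightarrow> nat \<Rightarrow> ('a, 'm) module \<Rightarrow> (nat \<Rightarrow> ('a, nat \<Rightarrow> 'a) module) \<Rightarrow>
   (nat \<Rightarrow> (nat \<Rightarrow> 'a) \<Rightarrow> (nat \<Rightarrow> 'a)) \<Rightarrow> ((nat \<Rightarrow> 'a) \<Rightarrow> 'm) \<Rightarrow> bool" where
  "finite_n_presentation R n E F d e \<longleftrightarrow>
     (\<forall>i\<le>n. free_module_of_finite_rank R (F i)) \<and>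
     (\<forall>i<n. d i \<in> module_hom R (F (Suc i)) (F i)) \<and>
     e \<in> module_hom R (F 0) E \<and>
     e ` carrier (F 0) = carrier E \<and>
     (0 < n \<longrightarrow> d 0 ` carrier (F 1) = a_kernel (F 0) E e) \<and>
     (\<forall>i. Suc i < n \<longrightarrow>
        d (Suc i) ` carrier (F (Suc (Suc i))) = a_kernel (F (Suc i)) (F i) (d i))"

definition pres_length :: "('a, 'r) ring_scheme \<Rightarrow> ('a, 'm) module \<Rightarrow> ereal" where
  "pres_length R E = (if fg_module R E
     then Sup {ereal (real n) | n. \<exists>F d e. finite_n_presentation R n E F d e}
     else -1)"

text \<open>The \<open>\<lambda>\<close>-dimension, as the infimum of a set of natural numbers in \<^typ>\<open>enat\<close>: the least
  element, or \<open>\<infinity>\<close> if the set is empty. A definition cannot quantify over all types, so the type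
  \<open>'m\<close> carrying the modules \<open>E\<close> is a parameter; statements about every module leave \<open>'m\<close>
  arbitrary. As every finitely generated module is a quotient of some \<open>R\<^sup>k\<close>, the choice
  \<open>'m = (nat \<Rightarrow> 'a) set\<close> already represents all of them up to isomorphism.\<close>

definition lambda_dim :: "'m itself \<Rightarrow> ('a, 'r) ring_scheme \<Rightarrow> enat" where
  "lambda_dim (_ :: 'm itself) R = Inf (enat ` {n. \<forall>E :: ('a, 'm) module. module R E \<longrightarrow>
     ereal (real n) \<le> pres_length R E \<longrightarrow> pres_length R E = \<infinity>})"

end

theory Submission
  imports Defs
begin

text \<open>Why the theorem holds. Iterating over a resolution, it is enough to treat a single matrix
  \<open>A : R\<^sup>m \<rightarrow> R\<^sup>n\<close>: if \<open>ker A\<close> is finitely generated, then it is even finitely presented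
  (\<open>local_fqp_kernel_fin_pres\<close>). For then some \<open>D : R\<^sup>k \<rightarrow> R\<^sup>m\<close> has image \<open>ker A\<close> and a
  finitely generated kernel, and the same statement applies to \<open>D\<close>. A module with a finite
  2-presentation yields such an \<open>A\<close>, namely the map \<open>F\<^sub>1 \<rightarrow> F\<^sub>0\<close> in coordinates.

  The ring theory behind this is a dichotomy (\<open>local_fqp_cases\<close>). If neither of \<open>a\<close>, \<open>b\<close> divides the
  other, then quasi-projectivity of \<open>(a, b)\<close> forces \<open>Ra \<inter> Rb = 0\<close> and \<open>ann a = ann b\<close>
  (\<open>local_fqp_pair\<close>); in particular \<open>a b = a\<^sup>2 = b\<^sup>2 = 0\<close>. Hence either divisibility is total, so
  that \<open>R\<close> is a chain ring, or the zero divisors form an ideal \<open>P\<close> with \<open>P\<^sup>2 = 0\<close>, and every element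
  outside \<open>P\<close> is regular, comparable with all elements, and divides all elements of \<open>P\<close>.

  In both cases the kernel of a matrix splits as a finite direct sum of ideals, by elimination of
  one column at a time (\<open>kernel_biproduct\<close>): an entry that divides all other entries serves
  as a pivot. Over a chain ring a pivot always exists and the summands are annihilators of
  elements. In the second case the summands are \<open>0\<close>, \<open>R\<close> and \<open>P\<close>. Summands of a finitely
  generated kernel are finitely generated, so it remains to see that these ideals are finitely
  presented as soon as they are finitely generated: over a chain ring, if \<open>ann a = Rb\<close> then \<open>ann b\<close> is
  again principal (\<open>double_annihilator_chain_ring\<close>); and the relations between the members of
  a minimal generating set of \<open>P\<close> have all their coefficients in \<open>P\<close>
  (\<open>fin_pres_sq_zero_divisible\<close>).\<close>

section \<open>Homomorphisms, kernels and generators\<close>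

lemma module_homI:
  assumes "\<And>x. x \<in> carrier V \<Longrightarrow> f x \<in> carrier W"
    and "\<And>x y. x \<in> carrier V \<Longrightarrow> y \<in> carrier V \<Longrightarrow> f (x \<oplus>\<^bsub>V\<^esub> y) = f x \<oplus>\<^bsub>W\<^esub> f y"
    and "\<And>r x. r \<in> carrier R \<Longrightarrow> x \<in> carrier V \<Longrightarrow> f (r \<odot>\<^bsub>V\<^esub> x) = r \<odot>\<^bsub>W\<^esub> f x"
  shows "f \<in> module_hom R V W"
  using assms by (auto simp: module_hom_def)

lemma module_hom_closed: "f \<in> module_hom R V W \<Longrightarrow> x \<in> carrier V \<Longrightarrow> f x \<in> carrier W"
  and module_hom_add: "f \<in> module_hom R V W \<Longrightarrow> x \<in> carrier V \<Longrightarrow> y \<in> carrier V \<Longrightarrow>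
    f (x \<oplus>\<^bsub>V\<^esub> y) = f x \<oplus>\<^bsub>W\<^esub> f y"
  and module_hom_smult: "f \<in> module_hom R V W \<Longrightarrow> r \<in> carrier R \<Longrightarrow> x \<in> carrier V \<Longrightarrow>
    f (r \<odot>\<^bsub>V\<^esub> x) = r \<odot>\<^bsub>W\<^esub> f x"
  by (auto simp: module_hom_def)

lemma module_hom_zero:
  assumes "module R V" "module R W" "f \<in> module_hom R V W"
  shows "f \<zero>\<^bsub>V\<^esub> = \<zero>\<^bsub>W\<^esub>"
proof -
  interpret V: module R V by fact
  interpret W: module R W by fact
  have "f (\<zero>\<^bsub>R\<^esub> \<odot>\<^bsub>V\<^esub> \<zero>\<^bsub>V\<^esub>) = \<zero>\<^bsub>R\<^esub> \<odot>\<^bsub>W\<^esub> f \<zero>\<^bsub>V\<^esub>"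
    using assms(3) by (intro module_hom_smult) auto
  then show ?thesis using module_hom_closed[OF assms(3), of "\<zero>\<^bsub>V\<^esub>"] by simp
qed

lemma module_hom_minus:
  assumes "module R V" "module R W" "f \<in> module_hom R V W" "x \<in> carrier V"
  shows "f (\<ominus>\<^bsub>V\<^esub> x) = \<ominus>\<^bsub>W\<^esub> f x"
proof -
  interpret V: module R V by fact
  interpret W: module R W by fact
  have "f ((\<ominus>\<^bsub>R\<^esub> \<one>\<^bsub>R\<^esub>) \<odot>\<^bsub>V\<^esub> x) = (\<ominus>\<^bsub>R\<^esub> \<one>\<^bsub>R\<^esub>) \<odot>\<^bsub>W\<^esub> f x"
    using assms(3,4) by (intro module_hom_smult) auto
  then show ?thesis using module_hom_closed[OF assms(3,4)] assms(4)
    by (simp add: V.smult_l_minus W.smult_l_minus)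
qed

lemma module_hom_comp:
  assumes "f \<in> module_hom R U V" "g \<in> module_hom R V W"
  shows "(\<lambda>x. g (f x)) \<in> module_hom R U W"
  using assms by (auto simp: module_hom_def Pi_iff)

lemma module_hom_sum:
  assumes "module R W" "f \<in> module_hom R V W" "g \<in> module_hom R V W"
  shows "(\<lambda>x. f x \<oplus>\<^bsub>W\<^esub> g x) \<in> module_hom R V W"
proof -
  interpret W: module R W by fact
  show ?thesis
  proof (rule module_homI)
    fix x y assume xy: "x \<in> carrier V" "y \<in> carrier V"
    note cl = module_hom_closed[OF assms(2) xy(1)] module_hom_closed[OF assms(2) xy(2)]
      module_hom_closed[OF assms(3) xy(1)] module_hom_closed[OF assms(3) xy(2)]
    show "f (x \<oplus>\<^bsub>V\<^esub> y) \<oplus>\<^bsub>W\<^esub> g (x \<oplus>\<^bsub>V\<^esub> y) = f x \<oplus>\<^bsub>W\<^esub> g x \<oplus>\<^bsub>W\<^esub> (f y \<oplus>\<^bsub>W\<^esub> g y)"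
      using cl by (simp add: module_hom_add[OF assms(2) xy] module_hom_add[OF assms(3) xy] W.a_ac)
  qed (use assms(2,3) in \<open>auto simp: module_hom_closed module_hom_smult W.smult_r_distr\<close>)
qed

lemma submodule_zero_mem:
  assumes "submodule U R W"
  shows "\<zero>\<^bsub>W\<^esub> \<in> U"
  using subgroup.one_closed[OF submodule.axioms(1)[OF assms]] by simp

lemma submodule_vimage:
  assumes V: "module R V" and W: "module R W" and f: "f \<in> module_hom R V W"
    and U: "submodule U R W"
  shows "submodule {x \<in> carrier V. f x \<in> U} R V"
proof -
  interpret V: module R V by fact
  interpret W: module R W by fact
  show ?thesis
    using W.submoduleE[OF U] submodule_zero_mem[OF U] f
    by (intro V.submoduleI)
       (auto simp: module_hom_add module_hom_smult module_hom_minus[OF V W f]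
          module_hom_zero[OF V W f])
qed

lemma submodule_zero:
  assumes "module R W"
  shows "submodule {\<zero>\<^bsub>W\<^esub>} R W"
proof -
  interpret W: module R W by fact
  show ?thesis by (intro W.submoduleI) auto
qed

lemma submodule_kernel:
  assumes "module R V" "module R W" "f \<in> module_hom R V W"
  shows "submodule (a_kernel V W f) R V"
  using submodule_vimage[OF assms submodule_zero[OF assms(2)]] by (simp add: a_kernel_def')

abbreviation ker_module :: "('a, 'm) module \<Rightarrow> ('a, 'n) module \<Rightarrow> ('m \<Rightarrow> 'n) \<Rightarrow> ('a, 'm) module" where
  "ker_module V W f \<equiv> V\<lparr>carrier := a_kernel V W f\<rparr>"

lemma module_ker_module:
  assumes "module R V" "module R W" "f \<in> module_hom R V W"
  shows "module R (ker_module V W f)"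
  using submodule.submodule_is_module[OF submodule_kernel[OF assms] assms(1)] .

text \<open>Generation is expressed through submodules instead of linear combinations, so that
  preimages and images of submodules prove everything about it and no finite sum has to be
  manipulated.\<close>

definition generates :: "('a, 'r) ring_scheme \<Rightarrow> ('a, 'm) module \<Rightarrow> 'm set \<Rightarrow> bool" where
  "generates R M B \<longleftrightarrow>
     B \<subseteq> carrier M \<and> (\<forall>U. submodule U R M \<longrightarrow> B \<subseteq> U \<longrightarrow> carrier M \<subseteq> U)"

definition fin_gen :: "('a, 'r) ring_scheme \<Rightarrow> ('a, 'm) module \<Rightarrow> bool" where
  "fin_gen R M \<longleftrightarrow> (\<exists>B. finite B \<and> generates R M B)"

lemma generatesD: "generates R M B \<Longrightarrow> submodule U R M \<Longrightarrow> B \<subseteq> U \<Longrightarrow> x \<in> carrier M \<Longrightarrow> x \<in> U"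
  by (auto simp: generates_def)

lemma fin_gen_image:
  assumes V: "module R V" and W: "module R W" and f: "f \<in> module_hom R V W"
    and surj: "f ` carrier V = carrier W" and fg: "fin_gen R V"
  shows "fin_gen R W"
proof -
  obtain B where B: "finite B" "generates R V B" using fg by (auto simp: fin_gen_def)
  have "generates R W (f ` B)"
    unfolding generates_def
  proof (intro conjI allI impI)
    show "f ` B \<subseteq> carrier W" using B(2) surj by (auto simp: generates_def)
    fix U assume U: "submodule U R W" "f ` B \<subseteq> U"
    have "B \<subseteq> {x \<in> carrier V. f x \<in> U}" using B(2) U(2) by (auto simp: generates_def)
    then have "f x \<in> U" if "x \<in> carrier V" for x
      using generatesD[OF B(2) submodule_vimage[OF V W f U(1)] _ that] by simp
    then show "carrier W \<subseteq> U" using surj by (metis image_subset_iff)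
  qed
  then show ?thesis using B(1) by (auto simp: fin_gen_def)
qed

text \<open>Applied to kernels that decompose as direct sums.\<close>

lemma fin_gen_sum:
  assumes V1: "module R V1" and V2: "module R V2" and W: "module R W"
    and f1: "f1 \<in> module_hom R V1 W" and f2: "f2 \<in> module_hom R V2 W"
    and sum: "\<And>w. w \<in> carrier W \<Longrightarrow> \<exists>x\<in>carrier V1. \<exists>y\<in>carrier V2. w = f1 x \<oplus>\<^bsub>W\<^esub> f2 y"
    and fg1: "fin_gen R V1" and fg2: "fin_gen R V2"
  shows "fin_gen R W"
proof -
  interpret W: module R W by fact
  obtain B1 where B1: "finite B1" "generates R V1 B1" using fg1 by (auto simp: fin_gen_def)
  obtain B2 where B2: "finite B2" "generates R V2 B2" using fg2 by (auto simp: fin_gen_def)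
  have "generates R W (f1 ` B1 \<union> f2 ` B2)"
    unfolding generates_def
  proof (intro conjI allI impI)
    show "f1 ` B1 \<union> f2 ` B2 \<subseteq> carrier W"
      using B1(2) B2(2) module_hom_closed[OF f1] module_hom_closed[OF f2]
      by (auto simp: generates_def)
    fix U assume U: "submodule U R W" "f1 ` B1 \<union> f2 ` B2 \<subseteq> U"
    have "B1 \<subseteq> {x \<in> carrier V1. f1 x \<in> U}" using B1(2) U(2) by (auto simp: generates_def)
    then have 1: "f1 x \<in> U" if "x \<in> carrier V1" for x
      using generatesD[OF B1(2) submodule_vimage[OF V1 W f1 U(1)] _ that] by simp
    have "B2 \<subseteq> {x \<in> carrier V2. f2 x \<in> U}" using B2(2) U(2) by (auto simp: generates_def)
    then have 2: "f2 x \<in> U" if "x \<in> carrier V2" for x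
      using generatesD[OF B2(2) submodule_vimage[OF V2 W f2 U(1)] _ that] by simp
    show "carrier W \<subseteq> U"
    proof
      fix w assume "w \<in> carrier W"
      then obtain x y where "x \<in> carrier V1" "y \<in> carrier V2" "w = f1 x \<oplus>\<^bsub>W\<^esub> f2 y"
        using sum by blast
      then show "w \<in> U"
        using W.submoduleE(5)[OF U(1) 1 2] by simp
    qed
  qed
  then show ?thesis unfolding fin_gen_def using B1(1) B2(1) finite_UnI finite_imageI by metis
qed

lemma fin_gen_trivial:
  assumes "module R W" "carrier W = {\<zero>\<^bsub>W\<^esub>}"
  shows "fin_gen R W"
proof -
  have "generates R W {}"
    unfolding generates_def using assms(2) submodule_zero_mem by auto
  then show ?thesis unfolding fin_gen_def by blast
qed

section \<open>Coordinate modules\<close>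

text \<open>The free module on an arbitrary set \<open>J\<close> of indices, as functions supported in \<open>J\<close>. All these
  modules share their operations, and only the carrier depends on \<open>J\<close>; so deleting a coordinate
  keeps the vectors as they are, without renumbering.\<close>

definition fvec :: "('a, 'r) ring_scheme \<Rightarrow> nat set \<Rightarrow> ('a, nat \<Rightarrow> 'a) module" where
  "fvec R J = \<lparr>carrier = {c. (\<forall>i. c i \<in> carrier R) \<and> (\<forall>i. i \<notin> J \<longrightarrow> c i = \<zero>\<^bsub>R\<^esub>)},
     monoid.mult = (\<lambda>x y i. x i \<otimes>\<^bsub>R\<^esub> y i), monoid.one = (\<lambda>i. \<one>\<^bsub>R\<^esub>), ring.zero = (\<lambda>i. \<zero>\<^bsub>R\<^esub>),
     ring.add = (\<lambda>x y i. x i \<oplus>\<^bsub>R\<^esub> y i), smult = (\<lambda>r x i. r \<otimes>\<^bsub>R\<^esub> x i)\<rparr>"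

definition unit_vec :: "('a, 'r) ring_scheme \<Rightarrow> nat \<Rightarrow> nat \<Rightarrow> 'a" where
  "unit_vec R q = (\<lambda>i. if i = q then \<one>\<^bsub>R\<^esub> else \<zero>\<^bsub>R\<^esub>)"

lemma fvec_simps:
  "c \<in> carrier (fvec R J) \<longleftrightarrow> (\<forall>i. c i \<in> carrier R) \<and> (\<forall>i. i \<notin> J \<longrightarrow> c i = \<zero>\<^bsub>R\<^esub>)"
  "\<zero>\<^bsub>fvec R J\<^esub> = (\<lambda>i. \<zero>\<^bsub>R\<^esub>)"
  "x \<oplus>\<^bsub>fvec R J\<^esub> y = (\<lambda>i. x i \<oplus>\<^bsub>R\<^esub> y i)"
  "r \<odot>\<^bsub>fvec R J\<^esub> x = (\<lambda>i. r \<otimes>\<^bsub>R\<^esub> x i)"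
  by (auto simp: fvec_def)

lemma ideal_module_simps:
  "carrier (ideal_module R I) = I" "\<zero>\<^bsub>ideal_module R I\<^esub> = \<zero>\<^bsub>R\<^esub>"
  "x \<oplus>\<^bsub>ideal_module R I\<^esub> y = x \<oplus>\<^bsub>R\<^esub> y" "r \<odot>\<^bsub>ideal_module R I\<^esub> x = r \<otimes>\<^bsub>R\<^esub> x"
  by (auto simp: ideal_module_def)

context cring
begin

lemma module_fvec: "module R (fvec R J)"
proof (rule moduleI)
  show "abelian_group (fvec R J)"
  proof (rule abelian_groupI)
    fix x assume "x \<in> carrier (fvec R J)"
    then show "\<exists>y\<in>carrier (fvec R J). y \<oplus>\<^bsub>fvec R J\<^esub> x = \<zero>\<^bsub>fvec R J\<^esub>"
      by (intro bexI[of _ "\<lambda>i. \<ominus> x i"]) (auto simp: fvec_simps l_neg)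
  qed (auto simp: fvec_simps a_assoc fun_eq_iff intro: a_comm)
qed (auto simp: fvec_simps l_distr r_distr m_assoc is_cring)

lemma module_ideal_module:
  assumes "ideal I R"
  shows "module R (ideal_module R I)"
proof -
  interpret ideal I R by fact
  show ?thesis
  proof (rule moduleI)
    show "abelian_group (ideal_module R I)"
    proof (rule abelian_groupI)
      fix x assume "x \<in> carrier (ideal_module R I)"
      then show "\<exists>y\<in>carrier (ideal_module R I). y \<oplus>\<^bsub>ideal_module R I\<^esub> x = \<zero>\<^bsub>ideal_module R I\<^esub>"
        by (intro bexI[of _ "\<ominus> x"]) (auto simp: ideal_module_simps l_neg)
    qed (auto simp: ideal_module_simps a_ac dest: Icarr)
  qed (auto simp: ideal_module_simps l_distr r_distr m_assoc I_l_closed is_cring)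
qed

abbreviation reg_module :: "('a, 'a) module" where
  "reg_module \<equiv> ideal_module R (carrier R)"

lemma module_reg_module: "module R reg_module"
  by (rule module_ideal_module[OF oneideal])

lemma unit_vec_closed: "q \<in> J \<Longrightarrow> unit_vec R q \<in> carrier (fvec R J)"
  by (auto simp: fvec_simps unit_vec_def)

lemma unit_vecs_generate:
  assumes J: "finite J" and U: "submodule U R (fvec R J)" and e: "\<And>j. j \<in> J \<Longrightarrow> unit_vec R j \<in> U"
    and c: "c \<in> carrier (fvec R J)"
  shows "c \<in> U"
proof -
  interpret F: module R "fvec R J" by (rule module_fvec)
  have "finite J' \<Longrightarrow> J' \<subseteq> J \<Longrightarrow> c \<in> carrier (fvec R J') \<Longrightarrow> c \<in> U" for J' c
  proof (induction J' arbitrary: c rule: finite_induct)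
    case empty
    then have "c = \<zero>\<^bsub>fvec R J\<^esub>" by (auto simp: fvec_simps)
    then show ?case using submodule_zero_mem[OF U] by simp
  next
    case (insert q J')
    have cq: "c i \<in> carrier R" for i using insert.prems(2) by (simp add: fvec_simps)
    have "c(q := \<zero>) \<in> U"
      using insert.prems by (intro insert.IH) (auto simp: fvec_simps)
    moreover have "c q \<odot>\<^bsub>fvec R J\<^esub> unit_vec R q \<in> U"
      using F.submoduleE(4)[OF U] e insert.prems(1) cq by blast
    moreover have "c = c(q := \<zero>) \<oplus>\<^bsub>fvec R J\<^esub> (c q \<odot>\<^bsub>fvec R J\<^esub> unit_vec R q)"
      using cq by (auto simp: fvec_simps unit_vec_def)
    ultimately show ?case using F.submoduleE(5)[OF U] by metis
  qed
  from this[OF J subset_refl c] show ?thesis .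
qed

lemma fin_gen_fvec:
  assumes "finite J"
  shows "fin_gen R (fvec R J)"
proof -
  have "generates R (fvec R J) (unit_vec R ` J)"
    unfolding generates_def
    using unit_vecs_generate[OF assms] unit_vec_closed by (auto simp: subset_iff)
  then show ?thesis using assms by (auto simp: fin_gen_def)
qed

text \<open>The equalizer of two homomorphisms is a submodule, and the unit vectors generate.\<close>

lemma fvec_hom_eqI:
  assumes J: "finite J" and W: "module R W" and f: "f \<in> module_hom R (fvec R J) W"
    and g: "g \<in> module_hom R (fvec R J) W"
    and e: "\<And>j. j \<in> J \<Longrightarrow> f (unit_vec R j) = g (unit_vec R j)"
    and c: "c \<in> carrier (fvec R J)"
  shows "f c = g c"
proof -
  interpret F: module R "fvec R J" by (rule module_fvec)
  interpret W: module R W by fact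
  have "submodule {c \<in> carrier (fvec R J). f c = g c} R (fvec R J)"
    using f g by (intro F.submoduleI)
      (auto simp: module_hom_add module_hom_smult module_hom_minus[OF module_fvec W]
          module_hom_zero[OF module_fvec W])
  from unit_vecs_generate[OF J this _ c] show ?thesis using e unit_vec_closed by auto
qed

text \<open>The homomorphism on \<open>fvec R J\<close> that the universal property of the free module assigns to the
  family \<open>x\<close>.\<close>

definition lincomb :: "nat set \<Rightarrow> ('a, 'm) module \<Rightarrow> (nat \<Rightarrow> 'm) \<Rightarrow> (nat \<Rightarrow> 'a) \<Rightarrow> 'm" where
  "lincomb J M x c = (\<Oplus>\<^bsub>M\<^esub>j\<in>J. c j \<odot>\<^bsub>M\<^esub> x j)"

lemma lincomb_hom:
  assumes M: "module R M" and J: "finite J" and x: "x \<in> J \<rightarrow> carrier M"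
  shows "lincomb J M x \<in> module_hom R (fvec R J) M"
proof -
  interpret M: module R M by fact
  have cl: "(\<lambda>j. c j \<odot>\<^bsub>M\<^esub> x j) \<in> J \<rightarrow> carrier M" if "c \<in> carrier (fvec R J)" for c
    using that x by (auto simp: fvec_simps)
  show ?thesis
  proof (rule module_homI)
    fix c assume c: "c \<in> carrier (fvec R J)"
    show "lincomb J M x c \<in> carrier M"
      unfolding lincomb_def using cl[OF c] by (rule M.finsum_closed)
    fix r assume r: "r \<in> carrier R"
    have "r \<odot>\<^bsub>M\<^esub> lincomb J M x c = (\<Oplus>\<^bsub>M\<^esub>j\<in>J. r \<odot>\<^bsub>M\<^esub> (c j \<odot>\<^bsub>M\<^esub> x j))"
      unfolding lincomb_def using M.finsum_smult_ldistr[OF J r cl[OF c]] .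
    also have "\<dots> = (\<Oplus>\<^bsub>M\<^esub>j\<in>J. (r \<otimes> c j) \<odot>\<^bsub>M\<^esub> x j)"
      using r c x by (intro M.finsum_cong') (auto simp: fvec_simps M.smult_assoc1 Pi_iff)
    finally show "lincomb J M x (r \<odot>\<^bsub>fvec R J\<^esub> c) = r \<odot>\<^bsub>M\<^esub> lincomb J M x c"
      by (simp add: lincomb_def fvec_simps)
  next
    fix c d assume c: "c \<in> carrier (fvec R J)" and d: "d \<in> carrier (fvec R J)"
    have "lincomb J M x (c \<oplus>\<^bsub>fvec R J\<^esub> d) = (\<Oplus>\<^bsub>M\<^esub>j\<in>J. (c j \<odot>\<^bsub>M\<^esub> x j) \<oplus>\<^bsub>M\<^esub> (d j \<odot>\<^bsub>M\<^esub> x j))"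
      unfolding lincomb_def using c d x
      by (intro M.finsum_cong') (auto simp: fvec_simps M.smult_l_distr Pi_iff)
    also have "\<dots> = lincomb J M x c \<oplus>\<^bsub>M\<^esub> lincomb J M x d"
      unfolding lincomb_def using M.finsum_addf[OF cl[OF c] cl[OF d]] .
    finally show "lincomb J M x (c \<oplus>\<^bsub>fvec R J\<^esub> d) = lincomb J M x c \<oplus>\<^bsub>M\<^esub> lincomb J M x d" .
  qed
qed

lemma lincomb_unit_vec:
  assumes M: "module R M" and J: "finite J" and x: "x \<in> J \<rightarrow> carrier M" and j: "j \<in> J"
  shows "lincomb J M x (unit_vec R j) = x j"
proof -
  interpret M: module R M by fact
  have "lincomb J M x (unit_vec R j) = (\<Oplus>\<^bsub>M\<^esub>i\<in>J. if j = i then x i else \<zero>\<^bsub>M\<^esub>)"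
    unfolding lincomb_def using x by (intro M.finsum_cong') (auto simp: unit_vec_def Pi_iff)
  also have "\<dots> = x j" using M.finsum_singleton[OF j J] x by auto
  finally show ?thesis .
qed

text \<open>The existence of one cover with finitely generated kernel is what a resolution built step by
  step calls for: each step chooses its own cover.\<close>

definition fin_pres :: "('a, 'm) module \<Rightarrow> bool" where
  "fin_pres K \<longleftrightarrow> (\<exists>J p. finite J \<and> p \<in> module_hom R (fvec R J) K \<and>
     p ` carrier (fvec R J) = carrier K \<and> fin_gen R (ker_module (fvec R J) K p))"

end

section \<open>Direct sum decompositions\<close>

text \<open>\<open>K\<close> is isomorphic to \<open>K1 \<oplus> K2\<close>. Injections and projections are used in place of a product
  module, because homomorphisms are what transports generators and presentations.\<close>

definition biproduct ::
  "('a, 'r) ring_scheme \<Rightarrow> ('a, 'm) module \<Rightarrow> ('a, 'n) module \<Rightarrow> ('a, 'k) module \<Rightarrow> bool" where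
  "biproduct R K K1 K2 \<longleftrightarrow> module R K \<and> module R K1 \<and> module R K2 \<and>
     (\<exists>i1\<in>module_hom R K1 K. \<exists>i2\<in>module_hom R K2 K. \<exists>p1\<in>module_hom R K K1. \<exists>p2\<in>module_hom R K K2.
       (\<forall>x\<in>carrier K. x = i1 (p1 x) \<oplus>\<^bsub>K\<^esub> i2 (p2 x)) \<and>
       (\<forall>y\<in>carrier K1. p1 (i1 y) = y \<and> p2 (i1 y) = \<zero>\<^bsub>K2\<^esub>) \<and>
       (\<forall>z\<in>carrier K2. p1 (i2 z) = \<zero>\<^bsub>K1\<^esub> \<and> p2 (i2 z) = z))"

lemma biproduct_fin_gen:
  assumes "biproduct R K K1 K2" "fin_gen R K"
  shows "fin_gen R K1" "fin_gen R K2"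
proof -
  obtain i1 i2 p1 p2 where h: "i1 \<in> module_hom R K1 K" "i2 \<in> module_hom R K2 K"
    "p1 \<in> module_hom R K K1" "p2 \<in> module_hom R K K2"
    and id: "\<And>y. y \<in> carrier K1 \<Longrightarrow> p1 (i1 y) = y" "\<And>y. y \<in> carrier K2 \<Longrightarrow> p2 (i2 y) = y"
    using assms(1) unfolding biproduct_def by metis
  have m: "module R K" "module R K1" "module R K2" using assms(1) unfolding biproduct_def by auto
  have "p1 ` carrier K = carrier K1"
    using module_hom_closed[OF h(1)] module_hom_closed[OF h(3)] id(1) by (force simp: image_iff)
  from fin_gen_image[OF m(1,2) h(3) this assms(2)] show "fin_gen R K1" .
  have "p2 ` carrier K = carrier K2"
    using module_hom_closed[OF h(2)] module_hom_closed[OF h(4)] id(2) by (force simp: image_iff)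
  from fin_gen_image[OF m(1,3) h(4) this assms(2)] show "fin_gen R K2" .
qed

context cring
begin

text \<open>The direct sum of two presentations is a presentation of the direct sum. The coordinates of the
  two covers are made disjoint by placing them at the even and at the odd indices.\<close>

lemma biproduct_fin_pres:
  assumes bp: "biproduct R K K1 K2" and fp1: "fin_pres K1" and fp2: "fin_pres K2"
  shows "fin_pres K"
proof -
  obtain i1 i2 p1 p2 where i1: "i1 \<in> module_hom R K1 K" and i2: "i2 \<in> module_hom R K2 K"
    and p1: "p1 \<in> module_hom R K K1" and p2: "p2 \<in> module_hom R K K2"
    and dec: "\<And>x. x \<in> carrier K \<Longrightarrow> x = i1 (p1 x) \<oplus>\<^bsub>K\<^esub> i2 (p2 x)"
    and id1: "\<And>y. y \<in> carrier K1 \<Longrightarrow> p1 (i1 y) = y \<and> p2 (i1 y) = \<zero>\<^bsub>K2\<^esub>"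
    and id2: "\<And>z. z \<in> carrier K2 \<Longrightarrow> p1 (i2 z) = \<zero>\<^bsub>K1\<^esub> \<and> p2 (i2 z) = z"
    using bp unfolding biproduct_def by metis
  have K: "module R K" and K1: "module R K1" and K2: "module R K2"
    using bp unfolding biproduct_def by auto
  interpret K: module R K by (rule K)
  interpret K1: module R K1 by (rule K1)
  interpret K2: module R K2 by (rule K2)
  obtain J1 q1 where J1: "finite J1" and q1: "q1 \<in> module_hom R (fvec R J1) K1"
    and s1: "q1 ` carrier (fvec R J1) = carrier K1"
    and g1: "fin_gen R (ker_module (fvec R J1) K1 q1)"
    using fp1 unfolding fin_pres_def by metis
  obtain J2 q2 where J2: "finite J2" and q2: "q2 \<in> module_hom R (fvec R J2) K2"
    and s2: "q2 ` carrier (fvec R J2) = carrier K2"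
    and g2: "fin_gen R (ker_module (fvec R J2) K2 q2)"
    using fp2 unfolding fin_pres_def by metis
  define J where "J = (\<lambda>i. 2 * i) ` J1 \<union> (\<lambda>i. 2 * i + 1) ` J2"
  define ev where "ev = (\<lambda>(c :: nat \<Rightarrow> 'a) i. c (2 * i))"
  define od where "od = (\<lambda>(c :: nat \<Rightarrow> 'a) i. c (2 * i + 1))"
  define mg where "mg = (\<lambda>(c :: nat \<Rightarrow> 'a) d i. if even i then c (i div 2) else d (i div 2))"
  have J: "finite J" using J1 J2 by (simp add: J_def)
  have evJ: "2 * i \<in> J \<longleftrightarrow> i \<in> J1" and odJ: "Suc (2 * i) \<in> J \<longleftrightarrow> i \<in> J2" for i
    unfolding J_def by (auto simp: image_iff) presburger+
  have ev: "ev \<in> module_hom R (fvec R J) (fvec R J1)"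
    by (rule module_homI) (auto simp: fvec_simps ev_def evJ)
  have od: "od \<in> module_hom R (fvec R J) (fvec R J2)"
    by (rule module_homI) (auto simp: fvec_simps od_def odJ)
  have mg: "mg c d \<in> carrier (fvec R J)" if "c \<in> carrier (fvec R J1)" "d \<in> carrier (fvec R J2)" for c d
  proof -
    have "mg c d i = \<zero>" if "i \<notin> J" for i
      using that \<open>c \<in> _\<close> \<open>d \<in> _\<close> evJ[of "i div 2"] odJ[of "i div 2"]
      by (cases "even i") (auto simp: mg_def fvec_simps)
    then show ?thesis using that by (auto simp: fvec_simps mg_def)
  qed
  have ev_mg: "ev (mg c d) = c" and od_mg: "od (mg c d) = d" for c d
    by (auto simp: ev_def od_def mg_def)
  have mg_ev: "mg (ev c) (od c) = c" for c
    by (auto simp: ev_def od_def mg_def fun_eq_iff)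
  define p where "p = (\<lambda>c. i1 (q1 (ev c)) \<oplus>\<^bsub>K\<^esub> i2 (q2 (od c)))"
  have p: "p \<in> module_hom R (fvec R J) K"
    unfolding p_def
    by (intro module_hom_sum[OF K] module_hom_comp[OF _ i1] module_hom_comp[OF _ i2]
        module_hom_comp[OF _ q1] module_hom_comp[OF _ q2] ev od)
  have p_mg: "p (mg c d) = i1 (q1 c) \<oplus>\<^bsub>K\<^esub> i2 (q2 d)" for c d
    by (simp add: p_def ev_mg od_mg)
  have surj: "p ` carrier (fvec R J) = carrier K"
  proof
    show "p ` carrier (fvec R J) \<subseteq> carrier K" using module_hom_closed[OF p] by blast
    show "carrier K \<subseteq> p ` carrier (fvec R J)"
    proof
      fix x assume x: "x \<in> carrier K"
      obtain c where c: "c \<in> carrier (fvec R J1)" "q1 c = p1 x"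
        using s1 module_hom_closed[OF p1 x] by (metis imageE)
      obtain d where d: "d \<in> carrier (fvec R J2)" "q2 d = p2 x"
        using s2 module_hom_closed[OF p2 x] by (metis imageE)
      have "p (mg c d) = x" using dec[OF x] c d by (simp add: p_mg)
      then show "x \<in> p ` carrier (fvec R J)" using mg[OF c(1) d(1)] by blast
    qed
  qed
  have ker: "c \<in> a_kernel (fvec R J) K p \<longleftrightarrow> c \<in> carrier (fvec R J) \<and>
      ev c \<in> a_kernel (fvec R J1) K1 q1 \<and> od c \<in> a_kernel (fvec R J2) K2 q2" for c
  proof (cases "c \<in> carrier (fvec R J)")
    case True
    have q: "q1 (ev c) \<in> carrier K1" "q2 (od c) \<in> carrier K2"
      using module_hom_closed[OF q1] module_hom_closed[OF q2] module_hom_closed[OF ev True]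
        module_hom_closed[OF od True] by auto
    have i: "i1 (q1 (ev c)) \<in> carrier K" "i2 (q2 (od c)) \<in> carrier K"
      using q module_hom_closed[OF i1] module_hom_closed[OF i2] by auto
    have "p c = \<zero>\<^bsub>K\<^esub> \<longleftrightarrow> q1 (ev c) = \<zero>\<^bsub>K1\<^esub> \<and> q2 (od c) = \<zero>\<^bsub>K2\<^esub>"
    proof
      assume 0: "p c = \<zero>\<^bsub>K\<^esub>"
      have "p1 (p c) = q1 (ev c)" "p2 (p c) = q2 (od c)"
        using module_hom_add[OF p1 i] module_hom_add[OF p2 i] id1[OF q(1)] id2[OF q(2)] q
        by (simp_all add: p_def)
      then show "q1 (ev c) = \<zero>\<^bsub>K1\<^esub> \<and> q2 (od c) = \<zero>\<^bsub>K2\<^esub>"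
        using 0 module_hom_zero[OF K K1 p1] module_hom_zero[OF K K2 p2] by simp
    next
      assume "q1 (ev c) = \<zero>\<^bsub>K1\<^esub> \<and> q2 (od c) = \<zero>\<^bsub>K2\<^esub>"
      then show "p c = \<zero>\<^bsub>K\<^esub>"
        using module_hom_zero[OF K1 K i1] module_hom_zero[OF K2 K i2] by (simp add: p_def)
    qed
    then show ?thesis using True module_hom_closed[OF ev True] module_hom_closed[OF od True]
      by (auto simp: a_kernel_def')
  qed (auto simp: a_kernel_def')
  define z where "z = (\<lambda>i :: nat. \<zero>)"
  have z: "z \<in> a_kernel (fvec R J1) K1 q1" "z \<in> a_kernel (fvec R J2) K2 q2"
    using submodule_zero_mem[OF submodule_kernel[OF module_fvec K1 q1]]
      submodule_zero_mem[OF submodule_kernel[OF module_fvec K2 q2]] by (auto simp: z_def fvec_simps)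
  have kc: "c \<in> a_kernel (fvec R J1) K1 q1 \<Longrightarrow> c \<in> carrier (fvec R J1)"
    "d \<in> a_kernel (fvec R J2) K2 q2 \<Longrightarrow> d \<in> carrier (fvec R J2)" for c d
    by (auto simp: a_kernel_def')
  have mg1: "mg c z \<in> a_kernel (fvec R J) K p" if "c \<in> a_kernel (fvec R J1) K1 q1" for c
    unfolding ker ev_mg od_mg using mg[OF kc(1) kc(2)] that z by simp
  have mg2: "mg z d \<in> a_kernel (fvec R J) K p" if "d \<in> a_kernel (fvec R J2) K2 q2" for d
    unfolding ker ev_mg od_mg using mg[OF kc(1) kc(2)] that z by simp
  have mg_lin: "mg (c \<oplus>\<^bsub>fvec R J1\<^esub> d) z = mg c z \<oplus>\<^bsub>fvec R J\<^esub> mg d z"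
    "mg z (c \<oplus>\<^bsub>fvec R J2\<^esub> d) = mg z c \<oplus>\<^bsub>fvec R J\<^esub> mg z d"
    "r \<in> carrier R \<Longrightarrow> mg (r \<odot>\<^bsub>fvec R J1\<^esub> c) z = r \<odot>\<^bsub>fvec R J\<^esub> mg c z"
    "r \<in> carrier R \<Longrightarrow> mg z (r \<odot>\<^bsub>fvec R J2\<^esub> c) = r \<odot>\<^bsub>fvec R J\<^esub> mg z c" for c d r
    by (simp_all add: mg_def z_def fvec_simps fun_eq_iff)
  have "fin_gen R (ker_module (fvec R J) K p)"
  proof (rule fin_gen_sum[OF _ _ _ _ _ _ g1 g2])
    show "(\<lambda>c. mg c z) \<in> module_hom R (ker_module (fvec R J1) K1 q1) (ker_module (fvec R J) K p)"
      by (rule module_homI) (simp_all add: mg1 mg_lin)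
    show "mg z \<in> module_hom R (ker_module (fvec R J2) K2 q2) (ker_module (fvec R J) K p)"
      by (rule module_homI) (simp_all add: mg2 mg_lin)
    fix w assume "w \<in> carrier (ker_module (fvec R J) K p)"
    then have w: "ev w \<in> a_kernel (fvec R J1) K1 q1" "od w \<in> a_kernel (fvec R J2) K2 q2"
      and wc: "w \<in> carrier (fvec R J)" by (auto simp: ker)
    have "w = mg (ev w) z \<oplus>\<^bsub>fvec R J\<^esub> mg z (od w)"
      using wc by (auto simp: fvec_simps mg_def z_def ev_def od_def fun_eq_iff)
    then show "\<exists>x\<in>carrier (ker_module (fvec R J1) K1 q1). \<exists>y\<in>carrier (ker_module (fvec R J2) K2 q2).
        w = mg x z \<oplus>\<^bsub>ker_module (fvec R J) K p\<^esub> mg z y"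
      using w by auto
  qed (intro module_ker_module module_fvec K K1 K2 q1 q2 p)+
  then show ?thesis using J p surj unfolding fin_pres_def by blast
qed

text \<open>One step of elimination. As \<open>u g = 1\<close>, the free module is \<open>Rg \<oplus> ker u\<close>, and as \<open>g q = 1\<close>, the
  map \<open>c \<mapsto> c - u(c) g\<close> identifies the vectors with \<open>q\<close>-th coordinate \<open>0\<close> with \<open>ker u\<close>; its
  inverse is \<open>c \<mapsto> c - c(q) g\<close>. The hypotheses on \<open>I\<close> say that the component \<open>u(c) g\<close> of a kernel vector
  \<open>c\<close> lies in \<open>I g\<close>, and that \<open>I g\<close> lies in the kernel. So the kernel splits along this decomposition.
  With a unit vector for \<open>g\<close> this clears a column by a pivot; with a kernel vector for
  \<open>g\<close> it splits off a free summand.\<close>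

lemma kernel_biproduct:
  assumes W: "module R W" and A: "A \<in> module_hom R (fvec R J) W" and q: "q \<in> J"
    and g: "g \<in> carrier (fvec R J)" "g q = \<one>"
    and u: "u \<in> module_hom R (fvec R J) reg_module" "u g = \<one>"
    and I: "ideal I R" and uI: "\<And>c. c \<in> carrier (fvec R J) \<Longrightarrow> A c = \<zero>\<^bsub>W\<^esub> \<Longrightarrow> u c \<in> I"
    and Ig: "\<And>z. z \<in> I \<Longrightarrow> z \<odot>\<^bsub>W\<^esub> A g = \<zero>\<^bsub>W\<^esub>"
  shows "\<exists>A'\<in>module_hom R (fvec R (J - {q})) W.
    biproduct R (ker_module (fvec R J) W A) (ker_module (fvec R (J - {q})) W A') (ideal_module R I)"
proof -
  interpret W: module R W by (rule W)
  interpret I: ideal I R by (rule I)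
  let ?F = "fvec R J" and ?G = "fvec R (J - {q})"
  have sub: "c \<in> carrier ?G \<Longrightarrow> c \<in> carrier ?F" for c by (auto simp: fvec_simps)
  have gi [simp]: "g i \<in> carrier R" for i using g by (simp add: fvec_simps)
  have uc: "c \<in> carrier ?F \<Longrightarrow> u c \<in> carrier R" for c
    using module_hom_closed[OF u(1)] by (simp add: ideal_module_simps)
  have u_add: "u (\<lambda>i. c i \<oplus> d i) = u c \<oplus> u d" if "c \<in> carrier ?F" "d \<in> carrier ?F" for c d
    using module_hom_add[OF u(1) that] by (simp add: ideal_module_simps fvec_simps)
  have u_smult: "u (\<lambda>i. r \<otimes> c i) = r \<otimes> u c" if "r \<in> carrier R" "c \<in> carrier ?F" for c r
    using module_hom_smult[OF u(1) that] by (simp add: ideal_module_simps fvec_simps)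
  have A_add: "A (\<lambda>i. c i \<oplus> d i) = A c \<oplus>\<^bsub>W\<^esub> A d" if "c \<in> carrier ?F" "d \<in> carrier ?F" for c d
    using module_hom_add[OF A that] by (simp add: fvec_simps)
  have A_smult: "A (\<lambda>i. r \<otimes> c i) = r \<odot>\<^bsub>W\<^esub> A c" if "r \<in> carrier R" "c \<in> carrier ?F" for c r
    using module_hom_smult[OF A that] by (simp add: fvec_simps)
  have Ac: "c \<in> carrier ?F \<Longrightarrow> A c \<in> carrier W" for c by (rule module_hom_closed[OF A])
  have mult_g: "(\<lambda>i. r \<otimes> g i) \<in> carrier ?F" if "r \<in> carrier R" for r
    using that g by (auto simp: fvec_simps)
  have Icarr: "z \<in> I \<Longrightarrow> z \<in> carrier R" for z by (rule I.Icarr)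
  define i1 where "i1 = (\<lambda>c i. c i \<oplus> (\<ominus> u c) \<otimes> g i)"
  define i2 where "i2 = (\<lambda>z i. z \<otimes> g i)"
  define p1 where "p1 = (\<lambda>c i. c i \<oplus> (\<ominus> c q) \<otimes> g i)"
  have i1: "i1 \<in> module_hom R ?G ?F"
  proof (rule module_homI)
    fix c assume c: "c \<in> carrier ?G"
    show "i1 c \<in> carrier ?F" using sub[OF c] uc[OF sub[OF c]] g by (auto simp: i1_def fvec_simps)
    fix r assume r: "r \<in> carrier R"
    show "i1 (r \<odot>\<^bsub>?G\<^esub> c) = r \<odot>\<^bsub>?F\<^esub> i1 c"
      using c r uc[OF sub[OF c]] u_smult[OF r sub[OF c]]
      by (auto simp: i1_def fvec_simps r_distr m_assoc l_minus r_minus)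
  next
    fix c d assume c: "c \<in> carrier ?G" and d: "d \<in> carrier ?G"
    have "c i \<in> carrier R" "d i \<in> carrier R" for i using c d by (auto simp: fvec_simps)
    then show "i1 (c \<oplus>\<^bsub>?G\<^esub> d) = i1 c \<oplus>\<^bsub>?F\<^esub> i1 d"
      using uc[OF sub[OF c]] uc[OF sub[OF d]] u_add[OF sub[OF c] sub[OF d]] gi
      by (simp add: i1_def fvec_simps minus_add l_distr a_ac)
  qed
  define A' where "A' = (\<lambda>c. A (i1 c))"
  have A': "A' \<in> module_hom R ?G W" unfolding A'_def by (rule module_hom_comp[OF i1 A])
  have u_i1: "u (i1 c) = \<zero>" if c: "c \<in> carrier ?G" for c
    using u_add[OF sub[OF c] mult_g] u_smult[OF _ g(1)] uc[OF sub[OF c]] u(2)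
    by (simp add: i1_def r_neg)
  have p1_i1: "p1 (i1 c) = c" if c: "c \<in> carrier ?G" for c
  proof -
    have [simp]: "c i \<in> carrier R" for i using c by (auto simp: fvec_simps)
    have "c q = \<zero>" using c by (auto simp: fvec_simps)
    then show ?thesis using uc[OF sub[OF c]] g(2)
      by (auto simp: p1_def i1_def fun_eq_iff a_assoc l_minus r_neg l_neg)
  qed
  have p1_G: "p1 c \<in> carrier ?G" if c: "c \<in> carrier ?F" for c
  proof -
    have [simp]: "c i \<in> carrier R" for i using c by (auto simp: fvec_simps)
    have "p1 c q = \<zero>" using g(2) by (simp add: p1_def l_minus r_neg l_neg)
    then show ?thesis using c g(1) by (auto simp: fvec_simps p1_def)
  qed
  have p1: "p1 \<in> module_hom R ?F ?G"
  proof (rule module_homI)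
    fix c assume c: "c \<in> carrier ?F"
    then show "p1 c \<in> carrier ?G" by (rule p1_G)
    fix r assume r: "r \<in> carrier R"
    then show "p1 (r \<odot>\<^bsub>?F\<^esub> c) = r \<odot>\<^bsub>?G\<^esub> p1 c"
      using c by (auto simp: p1_def fvec_simps r_distr m_assoc l_minus r_minus)
  next
    fix c d assume c: "c \<in> carrier ?F" and d: "d \<in> carrier ?F"
    have "c i \<in> carrier R" "d i \<in> carrier R" for i using c d by (auto simp: fvec_simps)
    then show "p1 (c \<oplus>\<^bsub>?F\<^esub> d) = p1 c \<oplus>\<^bsub>?G\<^esub> p1 d"
      using gi by (simp add: p1_def fvec_simps minus_add l_distr a_ac)
  qed
  have dec: "c = (\<lambda>i. i1 (p1 c) i \<oplus> i2 (u c) i)" if c: "c \<in> carrier ?F" for c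
  proof
    fix i
    have [simp]: "c i \<in> carrier R" for i using c by (auto simp: fvec_simps)
    note [simp] = uc[OF c]
    have "u (p1 c) = u c \<oplus> \<ominus> c q"
      using u_add[OF c mult_g] u_smult[OF _ g(1)] u(2) by (simp add: p1_def)
    then have "i1 (p1 c) i \<oplus> i2 (u c) i
        = c i \<oplus> (\<ominus> c q) \<otimes> g i \<oplus> (\<ominus> (u c \<oplus> \<ominus> c q)) \<otimes> g i \<oplus> u c \<otimes> g i"
      by (simp add: i1_def i2_def p1_def)
    also have "\<dots> = c i \<oplus> (\<ominus> (c q \<otimes> g i) \<oplus> c q \<otimes> g i) \<oplus> (\<ominus> (u c \<otimes> g i) \<oplus> u c \<otimes> g i)"
      by (simp add: minus_add l_distr l_minus a_ac)
    also have "\<dots> = c i" by (simp add: l_neg)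
    finally show "c i = i1 (p1 c) i \<oplus> i2 (u c) i" by simp
  qed
  have p1_i2: "p1 (i2 z) = (\<lambda>i. \<zero>)" if "z \<in> carrier R" for z
    using that g(2) by (auto simp: p1_def i2_def l_minus r_neg l_neg)
  have u_i2: "u (i2 z) = z" if "z \<in> carrier R" for z
    using u_smult[OF that g(1)] u(2) that by (simp add: i2_def)
  have A_i2: "A (i2 z) = \<zero>\<^bsub>W\<^esub>" if "z \<in> I" for z
    using A_smult[OF Icarr[OF that] g(1)] Ig[OF that] by (simp add: i2_def)
  have i2_F: "i2 z \<in> carrier ?F" if "z \<in> carrier R" for z using mult_g[OF that] by (simp add: i2_def)
  have A'_p1: "A' (p1 c) = A c" if c: "c \<in> carrier ?F" and 0: "A c = \<zero>\<^bsub>W\<^esub>" for c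
  proof -
    have "A c = A (i1 (p1 c)) \<oplus>\<^bsub>W\<^esub> A (i2 (u c))"
      using A_add[OF module_hom_closed[OF i1 p1_G[OF c]] i2_F[OF uc[OF c]]] dec[OF c] by simp
    then show ?thesis
      using A_i2[OF uI[OF c 0]] module_hom_closed[OF A' p1_G[OF c]] by (simp add: A'_def)
  qed
  have "biproduct R (ker_module ?F W A) (ker_module ?G W A') (ideal_module R I)"
    unfolding biproduct_def
  proof (intro conjI bexI ballI)
    show "i1 \<in> module_hom R (ker_module ?G W A') (ker_module ?F W A)"
      using i1 by (auto simp: module_hom_def a_kernel_def' A'_def)
    show "i2 \<in> module_hom R (ideal_module R I) (ker_module ?F W A)"
      using i2_F A_i2 Icarr
      by (intro module_homI)
         (auto simp: a_kernel_def' ideal_module_simps, auto simp: i2_def fvec_simps l_distr m_assoc)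
    show "p1 \<in> module_hom R (ker_module ?F W A) (ker_module ?G W A')"
      using p1 A'_p1 by (auto simp: module_hom_def a_kernel_def')
    show "u \<in> module_hom R (ker_module ?F W A) (ideal_module R I)"
      using u(1) uI by (auto simp: module_hom_def a_kernel_def' ideal_module_simps)
    show "module R (ker_module ?F W A)" by (rule module_ker_module[OF module_fvec W A])
    show "module R (ker_module ?G W A')" by (rule module_ker_module[OF module_fvec W A'])
    show "module R (ideal_module R I)" by (rule module_ideal_module[OF I])
  qed (use dec p1_i1 u_i1 p1_i2 u_i2 Icarr in
      \<open>auto simp: a_kernel_def' ideal_module_simps fvec_simps(2,3)\<close>)
  then show ?thesis using A' by blast
qed

end

section \<open>Local rings whose finitely generated ideals are quasi-projective\<close>

text \<open>A linear relation \<open>T\<close> that is total on \<open>V\<close> and single-valued modulo \<open>U\<close> is a homomorphism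
  \<open>V \<rightarrow> V/U\<close>. In this form quasi-projectivity applies to maps given by formulas in
  the coefficients of \<open>v\<close>, although these coefficients are not unique.\<close>

lemma quasi_projective_lift:
  assumes qp: "quasi_projective R V" and U: "submodule U R V"
    and T_dom: "\<And>v. v \<in> carrier V \<Longrightarrow> \<exists>w. T v w"
    and T_carr: "\<And>v w. T v w \<Longrightarrow> v \<in> carrier V \<and> w \<in> carrier V"
    and T_add: "\<And>v w v' w'. T v w \<Longrightarrow> T v' w' \<Longrightarrow> T (v \<oplus>\<^bsub>V\<^esub> v') (w \<oplus>\<^bsub>V\<^esub> w')"
    and T_smult: "\<And>r v w. r \<in> carrier R \<Longrightarrow> T v w \<Longrightarrow> T (r \<odot>\<^bsub>V\<^esub> v) (r \<odot>\<^bsub>V\<^esub> w)"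
    and T_zero: "\<And>w. T \<zero>\<^bsub>V\<^esub> w \<Longrightarrow> w \<in> U"
  shows "\<exists>f\<in>module_hom R V V. \<forall>v w. T v w \<longrightarrow> (\<exists>u\<in>U. f v = u \<oplus>\<^bsub>V\<^esub> w)"
proof -
  interpret V: module R V using qp by (simp add: quasi_projective_def)
  have "subgroup U (add_monoid V)" by (rule submodule.axioms(1)[OF U])
  then interpret U: abelian_subgroup U V
    by (intro abelian_subgroupI3 additive_subgroupI V.abelian_group_axioms)
  note U_cl = V.submoduleE[OF U]
  define g where "g = (\<lambda>v. U +>\<^bsub>V\<^esub> (SOME w. T v w))"
  have cos_eq: "U +>\<^bsub>V\<^esub> x = U +>\<^bsub>V\<^esub> y" if "y \<oplus>\<^bsub>V\<^esub> \<ominus>\<^bsub>V\<^esub> x \<in> U" "x \<in> carrier V" "y \<in> carrier V" for x y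
    using U.a_repr_independence'[OF U.a_rcos_module_rev[OF that(2,3,1)] that(2)] .
  have g: "g v = U +>\<^bsub>V\<^esub> w" if T: "T v w" for v w
  proof -
    define w' where "w' = (SOME w. T v w)"
    have T': "T v w'" unfolding w'_def using T by (rule someI)
    have c: "v \<in> carrier V" "w \<in> carrier V" "w' \<in> carrier V" using T_carr[OF T] T_carr[OF T'] by auto
    have "T (v \<oplus>\<^bsub>V\<^esub> (\<ominus>\<^bsub>R\<^esub> \<one>\<^bsub>R\<^esub>) \<odot>\<^bsub>V\<^esub> v) (w \<oplus>\<^bsub>V\<^esub> (\<ominus>\<^bsub>R\<^esub> \<one>\<^bsub>R\<^esub>) \<odot>\<^bsub>V\<^esub> w')"
      by (intro T_add T_smult T T') simp
    then have "w \<oplus>\<^bsub>V\<^esub> \<ominus>\<^bsub>V\<^esub> w' \<in> U"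
      using c by (intro T_zero) (simp add: V.smult_l_minus V.r_neg)
    then show ?thesis unfolding g_def w'_def[symmetric] using c by (intro cos_eq)
  qed
  have "g \<in> module_hom R V (quot_module V U)"
    unfolding module_hom_def
  proof (intro CollectI conjI ballI funcsetI)
    fix v assume "v \<in> carrier V"
    then obtain w where w: "T v w" using T_dom by blast
    show "g v \<in> carrier (quot_module V U)"
      using g[OF w] T_carr[OF w] V.a_rcosetsI[OF U_cl(1)] by (simp add: quot_module_def)
    fix r assume r: "r \<in> carrier R"
    have sub: "U +>\<^bsub>V\<^esub> (r \<odot>\<^bsub>V\<^esub> x) = U +>\<^bsub>V\<^esub> (r \<odot>\<^bsub>V\<^esub> w)" if x: "x \<in> U +>\<^bsub>V\<^esub> w" for x
    proof -
      obtain u where u: "u \<in> U" "x = u \<oplus>\<^bsub>V\<^esub> w" using x by (auto simp: a_r_coset_def')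
      have c: "u \<in> carrier V" "w \<in> carrier V" using u U_cl(1) T_carr[OF w] by auto
      have "r \<odot>\<^bsub>V\<^esub> x \<oplus>\<^bsub>V\<^esub> \<ominus>\<^bsub>V\<^esub> (r \<odot>\<^bsub>V\<^esub> w) = r \<odot>\<^bsub>V\<^esub> u"
        using u c r by (simp add: V.smult_r_distr V.add.m_assoc V.r_neg)
      then show ?thesis using U_cl(4)[OF r u(1)] u c r by (intro cos_eq[symmetric]) auto
    qed
    have "w \<in> U +>\<^bsub>V\<^esub> w" using U.a_rcos_self T_carr[OF w] by blast
    then have "(\<Union>x\<in>U +>\<^bsub>V\<^esub> w. U +>\<^bsub>V\<^esub> (r \<odot>\<^bsub>V\<^esub> x)) = U +>\<^bsub>V\<^esub> (r \<odot>\<^bsub>V\<^esub> w)"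
      using sub by blast
    then show "g (r \<odot>\<^bsub>V\<^esub> v) = r \<odot>\<^bsub>quot_module V U\<^esub> g v"
      using g[OF T_smult[OF r w]] g[OF w] by (simp add: quot_module_def)
  next
    fix v v' assume "v \<in> carrier V" "v' \<in> carrier V"
    then obtain w w' where w: "T v w" "T v' w'" using T_dom by meson
    show "g (v \<oplus>\<^bsub>V\<^esub> v') = g v \<oplus>\<^bsub>quot_module V U\<^esub> g v'"
      using g[OF T_add[OF w]] g[OF w(1)] g[OF w(2)] U.a_rcos_sum T_carr[OF w(1)] T_carr[OF w(2)]
      by (simp add: quot_module_def)
  qed
  then obtain f where f: "f \<in> module_hom R V V" "\<And>v. v \<in> carrier V \<Longrightarrow> g v = U +>\<^bsub>V\<^esub> f v"
    using qp U unfolding quasi_projective_def by metis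
  have "\<exists>u\<in>U. f v = u \<oplus>\<^bsub>V\<^esub> w" if T: "T v w" for v w
  proof -
    have "f v \<in> carrier V" using f(1) T_carr[OF T] by (auto simp: module_hom_def)
    then have "f v \<in> U +>\<^bsub>V\<^esub> w" using f(2) g[OF T] T_carr[OF T] U.a_rcos_self by metis
    then show ?thesis by (auto simp: a_r_coset_def')
  qed
  then show ?thesis using f(1) by blast
qed

context cring
begin

text \<open>Zorn's lemma for the ideals that contain \<open>a\<close> but not \<open>1\<close>.\<close>

lemma nonunit_in_maximalideal:
  assumes a: "a \<in> carrier R" "a \<notin> Units R"
  shows "\<exists>M. maximalideal M R \<and> a \<in> M"
proof -
  let ?\<I> = "{I. ideal I R \<and> a \<in> I \<and> \<one> \<notin> I}"
  have "\<one> \<notin> PIdl a"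
  proof
    assume "\<one> \<in> PIdl a"
    then obtain x where "x \<in> carrier R" "x \<otimes> a = \<one>" by (auto simp: cgenideal_def)
    then show False using a m_comm by (auto simp: Units_def)
  qed
  then have "PIdl a \<in> ?\<I>" using cgenideal_ideal cgenideal_self a by blast
  then have ne: "?\<I> \<noteq> {}" by blast
  have "\<Union>\<C> \<in> ?\<I>" if "\<C> \<noteq> {}" and ch: "subset.chain ?\<I> \<C>" for \<C>
  proof -
    have I: "ideal I R" "a \<in> I" "\<one> \<notin> I" if "I \<in> \<C>" for I
      using ch that by (auto simp: subset.chain_def)
    obtain I0 where I0: "I0 \<in> \<C>" using \<open>\<C> \<noteq> {}\<close> by blast
    have carr: "x \<in> carrier R" if "x \<in> \<Union>\<C>" for x using that ideal.Icarr[OF I(1)] by blast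
    have "ideal (\<Union>\<C>) R"
    proof (rule idealI[OF ring_axioms])
      show "subgroup (\<Union>\<C>) (add_monoid R)"
      proof (rule add.subgroupI)
        show "\<Union>\<C> \<subseteq> carrier R" using carr by blast
        show "\<Union>\<C> \<noteq> {}" using I0 I(2) by blast
        show "\<ominus> x \<in> \<Union>\<C>" if x: "x \<in> \<Union>\<C>" for x
        proof -
          obtain I where "I \<in> \<C>" "x \<in> I" using x by blast
          then show ?thesis
            using additive_subgroup.a_inv_closed[OF ideal.axioms(1)[OF I(1)]] by blast
        qed
        show "x \<oplus> y \<in> \<Union>\<C>" if x: "x \<in> \<Union>\<C>" and y: "y \<in> \<Union>\<C>" for x y
        proof -
          obtain I I' where "I \<in> \<C>" "x \<in> I" "I' \<in> \<C>" "y \<in> I'" using x y by blast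
          moreover then have "I \<subseteq> I' \<or> I' \<subseteq> I" using ch by (auto simp: subset.chain_def)
          ultimately obtain I where "I \<in> \<C>" "x \<in> I" "y \<in> I" by blast
          then show ?thesis
            using additive_subgroup.a_closed[OF ideal.axioms(1)[OF I(1)]] by blast
        qed
      qed
      show "x \<otimes> y \<in> \<Union>\<C>" if y: "y \<in> \<Union>\<C>" and x: "x \<in> carrier R" for x y
      proof -
        obtain I where "I \<in> \<C>" "y \<in> I" using y by blast
        then show ?thesis using ideal.I_l_closed[OF I(1)] x by blast
      qed
      then show "y \<otimes> x \<in> \<Union>\<C>" if y: "y \<in> \<Union>\<C>" and x: "x \<in> carrier R" for x y
        using m_comm[OF carr[OF y] x] x y by simp
    qed
    then show ?thesis using I0 I by blast
  qed
  from subset_Zorn_nonempty[OF ne this] obtain M where M: "ideal M R" "a \<in> M" "\<one> \<notin> M"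
    and max: "\<And>I. ideal I R \<Longrightarrow> a \<in> I \<Longrightarrow> \<one> \<notin> I \<Longrightarrow> M \<subseteq> I \<Longrightarrow> I = M" by auto
  have "maximalideal M R"
  proof (rule maximalidealI[OF M(1)])
    show "carrier R \<noteq> M" using M(3) by auto
    fix J assume "ideal J R" "M \<subseteq> J" "J \<subseteq> carrier R"
    then show "J = M \<or> J = carrier R"
      using max M(2) ideal.one_imp_carrier by blast
  qed
  then show ?thesis using M(2) by blast
qed

lemma local_ring_nonunits:
  assumes "local_ring R"
  shows "ideal (carrier R - Units R) R"
proof -
  obtain M where M: "maximalideal M R" and uniq: "\<And>N. maximalideal N R \<Longrightarrow> N = M"
    using assms by (auto simp: local_ring_def)
  interpret M: maximalideal M R by (rule M)
  have "M = carrier R - Units R"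
  proof
    show "M \<subseteq> carrier R - Units R"
    proof
      fix x assume x: "x \<in> M"
      have "x \<notin> Units R"
      proof
        assume "x \<in> Units R"
        then have "inv x \<otimes> x = \<one>" "inv x \<in> carrier R" by simp_all
        then have "\<one> \<in> M" using M.I_l_closed[OF x] by metis
        then show False using M.one_imp_carrier M.I_notcarr by blast
      qed
      then show "x \<in> carrier R - Units R" using M.Icarr[OF x] by blast
    qed
    show "carrier R - Units R \<subseteq> M" using nonunit_in_maximalideal uniq by blast
  qed
  then show ?thesis using M.is_ideal by simp
qed

lemma Idl_pair:
  assumes a: "a \<in> carrier R" and b: "b \<in> carrier R"
  shows "Idl {a, b} = {x \<otimes> a \<oplus> y \<otimes> b | x y. x \<in> carrier R \<and> y \<in> carrier R}"
proof -
  interpret J: ideal "Idl {a, b}" R using a b by (intro genideal_ideal) simp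
  have sum: "PIdl a <+>\<^bsub>R\<^esub> PIdl b = {x \<otimes> a \<oplus> y \<otimes> b | x y. x \<in> carrier R \<and> y \<in> carrier R}"
    by (auto simp: set_add_def' cgenideal_def)
  have "a = \<one> \<otimes> a \<oplus> \<zero> \<otimes> b" "b = \<zero> \<otimes> a \<oplus> \<one> \<otimes> b" using a b by simp_all
  then have "{a, b} \<subseteq> PIdl a <+>\<^bsub>R\<^esub> PIdl b" unfolding sum by blast
  then have "Idl {a, b} \<subseteq> PIdl a <+>\<^bsub>R\<^esub> PIdl b"
    using genideal_minimal[OF add_ideals[OF cgenideal_ideal[OF a] cgenideal_ideal[OF b]]] by simp
  moreover have "a \<in> Idl {a, b}" "b \<in> Idl {a, b}" using genideal_self[of "{a, b}"] a b by auto
  then have "x \<otimes> a \<oplus> y \<otimes> b \<in> Idl {a, b}" if "x \<in> carrier R" "y \<in> carrier R" for x y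
    using J.I_l_closed that by simp
  ultimately show ?thesis unfolding sum by blast
qed

lemma submodule_ideal_module:
  assumes "ideal I R" "ideal J R" "J \<subseteq> I" and M: "module R (ideal_module R I)"
  shows "submodule J R (ideal_module R I)"
proof -
  interpret M: module R "ideal_module R I" by (rule M)
  interpret J: ideal J R by fact
  show ?thesis
  proof (rule M.submoduleI)
    fix x assume x: "x \<in> J"
    then have xI: "x \<in> carrier (ideal_module R I)" using assms(3) by (auto simp: ideal_module_simps)
    have "\<ominus>\<^bsub>ideal_module R I\<^esub> x = (\<ominus> \<one>) \<odot>\<^bsub>ideal_module R I\<^esub> x"
      using M.smult_l_minus[OF one_closed xI] M.smult_one[OF xI] by simp
    then show "\<ominus>\<^bsub>ideal_module R I\<^esub> x \<in> J" using J.I_l_closed[OF x] by (simp add: ideal_module_simps)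
  qed (use assms(3) in \<open>auto simp: ideal_module_simps J.I_l_closed\<close>)
qed

lemma principal_image_ideal:
  assumes M: "ideal M R" and b: "b \<in> carrier R"
  shows "ideal {m \<otimes> b | m. m \<in> M} R"
proof -
  interpret M: ideal M R by (rule M)
  show ?thesis
  proof (rule idealI[OF ring_axioms])
    show "subgroup {m \<otimes> b | m. m \<in> M} (add_monoid R)"
    proof (rule add.subgroupI)
      show "{m \<otimes> b | m. m \<in> M} \<noteq> {}" using M.zero_closed by blast
      fix x assume "x \<in> {m \<otimes> b | m. m \<in> M}"
      then obtain m where m: "m \<in> M" "x = m \<otimes> b" by blast
      then have "\<ominus> x = (\<ominus> m) \<otimes> b" using b M.Icarr by (simp add: l_minus)
      then show "\<ominus> x \<in> {m \<otimes> b | m. m \<in> M}" using M.a_inv_closed[OF m(1)] by blast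
      fix y assume "y \<in> {m \<otimes> b | m. m \<in> M}"
      then obtain n where n: "n \<in> M" "y = n \<otimes> b" by blast
      then have "x \<oplus> y = (m \<oplus> n) \<otimes> b" using m b M.Icarr by (simp add: l_distr)
      then show "x \<oplus> y \<in> {m \<otimes> b | m. m \<in> M}" using m(1) n(1) by blast
    qed (use M.Icarr b in auto)
  next
    fix x r assume "x \<in> {m \<otimes> b | m. m \<in> M}" and r: "r \<in> carrier R"
    then obtain m where m: "m \<in> M" "x = m \<otimes> b" by blast
    then have "r \<otimes> x = (r \<otimes> m) \<otimes> b" using r b M.Icarr by (simp add: m_assoc)
    then show *: "r \<otimes> x \<in> {m \<otimes> b | m. m \<in> M}" using M.I_l_closed[OF m(1) r] by blast
    have "x \<otimes> r = r \<otimes> x" using m r b M.Icarr by (simp add: m_comm)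
    then show "x \<otimes> r \<in> {m \<otimes> b | m. m \<in> M}" using * by simp
  qed
qed

abbreviation incomparable :: "'a \<Rightarrow> 'a \<Rightarrow> bool" where
  "incomparable a b \<equiv> a \<in> carrier R \<and> b \<in> carrier R \<and> \<not> a divides b \<and> \<not> b divides a"

text \<open>In a local ring this puts the coefficients of any relation between incomparable elements into
  the maximal ideal.\<close>

lemma not_divides_coeff:
  assumes "b \<in> carrier R" "\<not> b divides a" "a \<in> carrier R" "x \<in> carrier R" "y \<in> carrier R"
    "x \<otimes> a = y \<otimes> b"
  shows "x \<notin> Units R"
proof
  assume x: "x \<in> Units R"
  then have "a = inv x \<otimes> (x \<otimes> a)" using assms(1-5) x by (simp add: m_assoc[symmetric])
  also have "\<dots> = b \<otimes> (inv x \<otimes> y)" using assms x by (simp add: m_ac)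
  finally show False using assms(1,2,5) x by (auto intro: dividesI)
qed

text \<open>Both parts lift an endomorphism of \<open>I = (a, b)\<close> from a quotient. Since \<open>a\<close> and \<open>b\<close> are
  incomparable, all coefficients of relations between them lie in the maximal ideal \<open>M\<close>.

  Disjointness: lifting \<open>x a + y b \<mapsto> x a\<close> modulo \<open>Ra \<inter> Rb\<close> gives \<open>f\<close> with \<open>f a = (1 + s) a\<close> and
  \<open>f b = q b\<close>, where \<open>s, q \<in> M\<close>. On an element \<open>z\<close> of \<open>Ra \<inter> Rb\<close> both formulas hold, so
  \<open>(1 + s - q) z = 0\<close> with a unit as coefficient.

  Annihilators: lifting \<open>x a + y b \<mapsto> x b\<close> modulo \<open>M b\<close> gives \<open>f a = (1 + m) b\<close> with \<open>m \<in> M\<close>,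
  and so \<open>x a = 0\<close> implies \<open>x b = 0\<close>.\<close>

lemma local_fqp_pair:
  assumes loc: "local_ring R" and fqp: "fqp_ring R" and ab: "incomparable a b"
  shows local_fqp_disjoint: "x \<in> carrier R \<Longrightarrow> y \<in> carrier R \<Longrightarrow> x \<otimes> a = y \<otimes> b \<Longrightarrow> x \<otimes> a = \<zero>"
    and local_fqp_annihilator: "x \<in> carrier R \<Longrightarrow> x \<otimes> a = \<zero> \<Longrightarrow> x \<otimes> b = \<zero>"
proof -
  have a: "a \<in> carrier R" and b: "b \<in> carrier R" using ab by auto
  define M where "M = carrier R - Units R"
  interpret M: ideal M R unfolding M_def by (rule local_ring_nonunits[OF loc])
  have unit: "\<one> \<oplus> m \<in> Units R" if m: "m \<in> M" for m
  proof (rule ccontr)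
    assume "\<one> \<oplus> m \<notin> Units R"
    then have "\<one> \<oplus> m \<in> M" using M.Icarr[OF m] by (simp add: M_def)
    then have "(\<one> \<oplus> m) \<oplus> \<ominus> m \<in> M" using M.a_inv_closed[OF m] by blast
    then have "\<one> \<in> M" using M.Icarr[OF m] by (simp add: a_assoc r_neg)
    then show False by (simp add: M_def)
  qed
  have cancel: "x = \<zero>" if "m \<in> M" "(\<one> \<oplus> m) \<otimes> x = \<zero>" "x \<in> carrier R" for m x
    using unit[OF that(1)] that(2,3) Units_l_cancel[of "\<one> \<oplus> m" x \<zero>] Units_closed by simp
  have coeff: "x \<in> M" "y \<in> M" if "x \<in> carrier R" "y \<in> carrier R" "x \<otimes> a = y \<otimes> b" for x y
    using not_divides_coeff[OF b _ a that] not_divides_coeff[OF a _ b that(2,1) that(3)[symmetric]] ab that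
    by (auto simp: M_def)
  define I where "I = Idl {a, b}"
  have I: "I = {x \<otimes> a \<oplus> y \<otimes> b | x y. x \<in> carrier R \<and> y \<in> carrier R}"
    unfolding I_def by (rule Idl_pair[OF a b])
  have Iideal: "ideal I R" unfolding I_def using a b by (intro genideal_ideal) simp
  interpret I: ideal I R by (rule Iideal)
  have qp: "quasi_projective R (ideal_module R I)"
    using fqp a b unfolding fqp_ring_def I_def by simp
  have mI: "module R (ideal_module R I)" using qp by (simp add: quasi_projective_def)
  have aI: "a \<in> I" and bI: "b \<in> I" unfolding I_def using genideal_self[of "{a, b}"] a b by auto
  have f_smult: "f (r \<otimes> v) = r \<otimes> f v" if "f \<in> module_hom R (ideal_module R I) (ideal_module R I)" "r \<in> carrier R" "v \<in> I" for f r v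
    using that by (auto simp: module_hom_def ideal_module_simps)
  \<comment> \<open>The common lifting step: \<open>x a + y b \<mapsto> x t\<close>, for \<open>t = b\<close> and for \<open>t = a\<close>, modulo \<open>U\<close>.\<close>
  have T: "\<exists>f\<in>module_hom R (ideal_module R I) (ideal_module R I).
      \<forall>x\<in>carrier R. \<forall>y\<in>carrier R. \<exists>u\<in>U. f (x \<otimes> a \<oplus> y \<otimes> b) = u \<oplus> x \<otimes> t"
    if t: "t \<in> I" and U: "ideal U R" "U \<subseteq> I"
      and zero: "\<And>x y. x \<in> carrier R \<Longrightarrow> y \<in> carrier R \<Longrightarrow> x \<otimes> a \<oplus> y \<otimes> b = \<zero> \<Longrightarrow> x \<otimes> t \<in> U" for t U
  proof -
    let ?V = "ideal_module R I"
    define T where "T = (\<lambda>v w. \<exists>x\<in>carrier R. \<exists>y\<in>carrier R. v = x \<otimes> a \<oplus> y \<otimes> b \<and> w = x \<otimes> t)"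
    have tc: "t \<in> carrier R" using I.Icarr t .
    have "\<exists>f\<in>module_hom R ?V ?V. \<forall>v w. T v w \<longrightarrow> (\<exists>u\<in>U. f v = u \<oplus>\<^bsub>?V\<^esub> w)"
    proof (rule quasi_projective_lift[OF qp submodule_ideal_module[OF Iideal U mI]])
      show "\<exists>w. T v w" if v: "v \<in> carrier ?V" for v
      proof -
        obtain x y where "x \<in> carrier R" "y \<in> carrier R" "v = x \<otimes> a \<oplus> y \<otimes> b"
          using v unfolding ideal_module_simps I by blast
        then have "T v (x \<otimes> t)" unfolding T_def by blast
        then show ?thesis ..
      qed
      show "v \<in> carrier ?V \<and> w \<in> carrier ?V" if "T v w" for v w
      proof -
        obtain x y where xy: "x \<in> carrier R" "y \<in> carrier R" "v = x \<otimes> a \<oplus> y \<otimes> b" "w = x \<otimes> t"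
          using \<open>T v w\<close> by (auto simp: T_def)
        then have "v \<in> I" unfolding I by blast
        then show ?thesis using xy I.I_l_closed[OF t] by (simp add: ideal_module_simps)
      qed
      show "w \<in> U" if T: "T \<zero>\<^bsub>?V\<^esub> w" for w
      proof -
        obtain x y where xy: "x \<in> carrier R" "y \<in> carrier R" "\<zero> = x \<otimes> a \<oplus> y \<otimes> b" "w = x \<otimes> t"
          using T unfolding T_def ideal_module_simps by blast
        show ?thesis unfolding xy(4) by (rule zero[OF xy(1,2) xy(3)[symmetric]])
      qed
      show "T (r \<odot>\<^bsub>?V\<^esub> v) (r \<odot>\<^bsub>?V\<^esub> w)" if r: "r \<in> carrier R" and "T v w" for r v w
      proof -
        obtain x y where "x \<in> carrier R" "y \<in> carrier R" "v = x \<otimes> a \<oplus> y \<otimes> b" "w = x \<otimes> t"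
          using \<open>T v w\<close> by (auto simp: T_def)
        then show ?thesis unfolding T_def ideal_module_simps using r a b tc
          by (intro bexI[of _ "r \<otimes> x"] bexI[of _ "r \<otimes> y"]) (auto simp: r_distr m_assoc)
      qed
      show "T (v \<oplus>\<^bsub>?V\<^esub> v') (w \<oplus>\<^bsub>?V\<^esub> w')" if "T v w" "T v' w'" for v w v' w'
      proof -
        obtain x y where "x \<in> carrier R" "y \<in> carrier R" "v = x \<otimes> a \<oplus> y \<otimes> b" "w = x \<otimes> t"
          using \<open>T v w\<close> by (auto simp: T_def)
        moreover obtain x' y' where "x' \<in> carrier R" "y' \<in> carrier R" "v' = x' \<otimes> a \<oplus> y' \<otimes> b" "w' = x' \<otimes> t"
          using \<open>T v' w'\<close> by (auto simp: T_def)
        ultimately show ?thesis unfolding T_def ideal_module_simps using a b tc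
          by (intro bexI[of _ "x \<oplus> x'"] bexI[of _ "y \<oplus> y'"]) (auto simp: l_distr a_ac)
      qed
    qed
    then obtain f where f: "f \<in> module_hom R ?V ?V" "\<And>v w. T v w \<Longrightarrow> \<exists>u\<in>U. f v = u \<oplus> w"
      by (auto simp: ideal_module_simps)
    have "\<exists>u\<in>U. f (x \<otimes> a \<oplus> y \<otimes> b) = u \<oplus> x \<otimes> t" if "x \<in> carrier R" "y \<in> carrier R" for x y
      by (rule f(2)) (use that in \<open>auto simp: T_def\<close>)
    with f(1) show ?thesis by blast
  qed
  have neg: "x \<otimes> a = (\<ominus> y) \<otimes> b" if "x \<in> carrier R" "y \<in> carrier R" "x \<otimes> a \<oplus> y \<otimes> b = \<zero>" for x y
    using minus_equality[OF that(3)] that(1,2) a b by (simp add: l_minus)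
  show "x \<otimes> b = \<zero>" if x: "x \<in> carrier R" "x \<otimes> a = \<zero>"
  proof -
    let ?U = "{m \<otimes> b | m. m \<in> M}"
    have U1: "ideal ?U R" by (rule principal_image_ideal[OF M.is_ideal b])
    have U2: "?U \<subseteq> I" using I.I_l_closed[OF bI] M.Icarr by blast
    have U3: "x \<otimes> b \<in> ?U" if "x \<in> carrier R" "y \<in> carrier R" "x \<otimes> a \<oplus> y \<otimes> b = \<zero>" for x y
      using coeff[OF that(1) a_inv_closed[OF that(2)] neg[OF that]] by blast
    from T[OF bI U1 U2 U3]
    obtain f where f: "f \<in> module_hom R (ideal_module R I) (ideal_module R I)"
      and fT: "\<forall>x\<in>carrier R. \<forall>y\<in>carrier R. \<exists>u\<in>?U. f (x \<otimes> a \<oplus> y \<otimes> b) = u \<oplus> x \<otimes> b" ..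
    obtain u m where m: "m \<in> M" "u = m \<otimes> b" "f (\<one> \<otimes> a \<oplus> \<zero> \<otimes> b) = u \<oplus> \<one> \<otimes> b" using bspec[OF bspec[OF fT one_closed] zero_closed] by blast
    then have fa: "f a = (\<one> \<oplus> m) \<otimes> b" using a b M.Icarr by (simp add: l_distr a_comm)
    have "f \<zero> = \<zero>" using f_smult[OF f zero_closed aI] fa a b M.Icarr[OF m(1)] by simp
    then have "x \<otimes> ((\<one> \<oplus> m) \<otimes> b) = \<zero>" using f_smult[OF f x(1) aI] fa x(2) by simp
    then have "(\<one> \<oplus> m) \<otimes> (x \<otimes> b) = \<zero>" using x(1) b M.Icarr[OF m(1)] by (simp add: m_ac)
    then show ?thesis using cancel[OF m(1)] x(1) b by simp
  qed
  show "x \<otimes> a = \<zero>" if x: "x \<in> carrier R" "y \<in> carrier R" "x \<otimes> a = y \<otimes> b"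
  proof -
    let ?U = "PIdl a \<inter> PIdl b"
    have U1: "ideal ?U R" by (intro i_intersect cgenideal_ideal a b)
    have U2: "?U \<subseteq> I" using I.I_l_closed[OF aI] by (auto simp: cgenideal_def)
    have U3: "x \<otimes> a \<in> ?U" if "x \<in> carrier R" "y \<in> carrier R" "x \<otimes> a \<oplus> y \<otimes> b = \<zero>" for x y
      unfolding cgenideal_def using neg[OF that] that(1) a_inv_closed[OF that(2)] by blast
    from T[OF aI U1 U2 U3]
    obtain f where f: "f \<in> module_hom R (ideal_module R I) (ideal_module R I)"
      and fT: "\<forall>x\<in>carrier R. \<forall>y\<in>carrier R. \<exists>u\<in>?U. f (x \<otimes> a \<oplus> y \<otimes> b) = u \<oplus> x \<otimes> a" ..
    obtain u where u: "u \<in> ?U" "f (\<one> \<otimes> a \<oplus> \<zero> \<otimes> b) = u \<oplus> \<one> \<otimes> a" using bspec[OF bspec[OF fT one_closed] zero_closed] by blast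
    obtain v where v: "v \<in> ?U" "f (\<zero> \<otimes> a \<oplus> \<one> \<otimes> b) = v \<oplus> \<zero> \<otimes> a" using bspec[OF bspec[OF fT zero_closed] one_closed] by blast
    obtain s s' where s: "s \<in> carrier R" "s' \<in> carrier R" "u = s \<otimes> a" "u = s' \<otimes> b"
      using u(1) by (auto simp: cgenideal_def)
    obtain p q where q: "p \<in> carrier R" "q \<in> carrier R" "v = p \<otimes> a" "v = q \<otimes> b"
      using v(1) by (auto simp: cgenideal_def)
    have sM: "s \<in> M" using coeff[OF s(1,2)] s(3,4) by simp
    have qM: "q \<in> M" using coeff(2)[OF q(1,2)] q(3,4) by simp
    have fa: "f a = (\<one> \<oplus> s) \<otimes> a" using u(2) a b s by (simp add: l_distr a_comm)
    have fb: "f b = q \<otimes> b" using v(2) a b q by simp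
    have "x \<otimes> ((\<one> \<oplus> s) \<otimes> a) = y \<otimes> (q \<otimes> b)"
      using f_smult[OF f x(1) aI] f_smult[OF f x(2) bI] fa fb x(3) by simp
    moreover have "x \<otimes> ((\<one> \<oplus> s) \<otimes> a) = (\<one> \<oplus> s) \<otimes> (x \<otimes> a)"
      using x(1) s(1) a by (intro m_lcomm) auto
    moreover have "y \<otimes> (q \<otimes> b) = q \<otimes> (y \<otimes> b)" using x(2) q(2) b by (intro m_lcomm)
    ultimately have "(\<one> \<oplus> s) \<otimes> (x \<otimes> a) = q \<otimes> (x \<otimes> a)" using x(3) by simp
    then have "(\<one> \<oplus> (s \<oplus> \<ominus> q)) \<otimes> (x \<otimes> a) = \<zero>"
      using x s(1) q(2) a b by (simp add: a_assoc[symmetric] l_distr[of "\<one> \<oplus> s"] l_minus r_neg)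
    moreover have "s \<oplus> \<ominus> q \<in> M" using sM qM by blast
    ultimately show ?thesis using cancel x(1) a by simp
  qed
qed

text \<open>The shape of a local fqp-ring that is not a chain ring: \<open>P\<close> is its set of zero divisors. Modulo \<open>P\<close>
  the ring is a valuation domain, over which \<open>P\<close> is torsion-free and divisible.\<close>

definition sq_zero_divisible :: "'a set \<Rightarrow> bool" where
  "sq_zero_divisible P \<longleftrightarrow> ideal P R \<and> (\<forall>x\<in>P. \<forall>y\<in>P. x \<otimes> y = \<zero>) \<and>
     (\<forall>c\<in>carrier R - P. (\<forall>z\<in>carrier R. c \<otimes> z = \<zero> \<longrightarrow> z = \<zero>) \<and> (\<forall>z\<in>P. c divides z) \<and>
       (\<forall>z\<in>carrier R. c divides z \<or> z divides c))"

text \<open>Given incomparable \<open>a\<close> and \<open>b\<close>, the ideal \<open>P\<close> is \<open>ann a = ann b\<close>. The facts used about any such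
  pair are: \<open>a b = 0\<close> and \<open>a\<^sup>2 = 0\<close>; and an element that is incomparable to \<open>a\<close> or to \<open>b\<close> has the
  same annihilator as \<open>a\<close>.\<close>

lemma local_fqp_cases:
  assumes loc: "local_ring R" and fqp: "fqp_ring R"
  shows "(\<forall>a\<in>carrier R. \<forall>b\<in>carrier R. a divides b \<or> b divides a) \<or>
    (\<exists>P. sq_zero_divisible P)"
proof (cases "\<forall>a\<in>carrier R. \<forall>b\<in>carrier R. a divides b \<or> b divides a")
  case False
  then obtain a b where ab: "incomparable a b" by blast
  have ann: "z \<otimes> c = \<zero> \<Longrightarrow> z \<otimes> d = \<zero>" if "incomparable c d" "z \<in> carrier R" for c d z
    using local_fqp_annihilator[OF loc fqp that(1,2)] .
  have prod: "c \<otimes> d = \<zero>" if cd: "incomparable c d" for c d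
    using local_fqp_disjoint[OF loc fqp, of d c c d] cd m_comm[of c d] by auto
  have sq: "c \<otimes> c = \<zero>" if cd: "incomparable c d" for c d
    using ann[of d c c] prod[OF cd] cd by auto
  have nz: "c \<noteq> \<zero>" if cd: "incomparable c d" for c d
    using cd by (metis divides_zero)
  \<comment> \<open>\<open>P\<close> annihilates every element that fails to divide one of \<open>a\<close> and \<open>b\<close>.\<close>
  have ann_z: "y \<otimes> z = \<zero>"
    if ab: "incomparable a b" and y: "y \<in> carrier R" "y \<otimes> a = \<zero>"
      and z: "z \<in> carrier R" "\<not> z divides a \<or> \<not> z divides b" for a b y z
  proof -
    have *: "y \<otimes> z = \<zero>" if ab: "incomparable a b" and y: "y \<in> carrier R" "y \<otimes> a = \<zero>"
      and z: "z \<in> carrier R" "\<not> z divides a" for a b y z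
    proof (cases "a divides z")
      case True
      then obtain r where "r \<in> carrier R" "z = a \<otimes> r" by (auto elim: dividesE)
      then show ?thesis using y ab by (simp add: m_assoc[symmetric])
    next
      case False
      then show ?thesis using ann[of a z y] ab y z by blast
    qed
    show ?thesis using *[of a b y z] *[of b a y z] ann[of a b y] that by blast
  qed
  \<comment> \<open>An element \<open>c\<close> outside \<open>P\<close> is regular. A nonzero \<open>z\<close> with \<open>c z = 0\<close> would have to divide \<open>a\<close>,
    since otherwise \<open>z\<close> has the same annihilator as \<open>a\<close>; but then \<open>c\<close> annihilates \<open>a\<close>.\<close>
  have regular: "z = \<zero>"
    if ab: "incomparable a b" and c: "c \<in> carrier R" "c \<otimes> a \<noteq> \<zero>"
      and z: "z \<in> carrier R" "c \<otimes> z = \<zero>" for a b c z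
  proof (rule ccontr)
    assume "z \<noteq> \<zero>"
    \<comment> \<open>If \<open>a\<close> divides \<open>z\<close>, then \<open>z\<close> is incomparable to \<open>b\<close>, because \<open>Ra \<inter> Rb = 0\<close>; so \<open>ann z = ann b\<close>.\<close>
    have step: False if ab: "incomparable a b" and ca: "c \<otimes> a \<noteq> \<zero>" and za: "\<not> z divides a" for a b
    proof (cases "a divides z")
      case False
      then show False using ann[of z a c] ab za z c ca by blast
    next
      case True
      then obtain r where r: "r \<in> carrier R" "z = a \<otimes> r" by (auto elim: dividesE)
      have "\<not> z divides b" using True ab z by (meson divides_trans)
      moreover have "\<not> b divides z"
      proof
        assume "b divides z"
        then obtain s where "s \<in> carrier R" "z = b \<otimes> s" by (auto elim: dividesE)
        then have "r \<otimes> a = \<zero>" using local_fqp_disjoint[OF loc fqp ab r(1)] r ab by (simp add: m_comm)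
        then show False using r ab \<open>z \<noteq> \<zero>\<close> by (simp add: m_comm)
      qed
      ultimately have "c \<otimes> b = \<zero>" using ann[of z b c] ab z c by blast
      then show False using ann[of b a c] ab c ca by blast
    qed
    have "z divides a" using step[OF ab c(2)] by blast
    then obtain w where w: "w \<in> carrier R" "a = z \<otimes> w" by (auto elim: dividesE)
    then have "c \<otimes> a = (c \<otimes> z) \<otimes> w" using c(1) z(1) by (simp add: m_ac)
    then show False using c z w by simp
  qed
  define P where "P = {z \<in> carrier R. z \<otimes> a = \<zero>}"
  have P: "ideal P R"
  proof (rule idealI[OF ring_axioms])
    show "subgroup P (add_monoid R)"
      using ab by (intro add.subgroupI) (auto simp: P_def l_distr l_minus)
    fix x y assume x: "x \<in> P" and y: "y \<in> carrier R"
    have "y \<otimes> x \<otimes> a = y \<otimes> (x \<otimes> a)" using x y ab by (simp add: P_def m_assoc)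
    then show *: "y \<otimes> x \<in> P" using x y by (simp add: P_def)
    then show "x \<otimes> y \<in> P" using x y m_comm[of x y] by (simp add: P_def)
  qed
  have "x \<otimes> y = \<zero>" if "x \<in> P" "y \<in> P" for x y
  proof (cases "y divides a \<and> y divides b")
    case False
    then show ?thesis using ann_z[OF ab, of x y] that by (auto simp: P_def)
  next
    case True
    then obtain w w' where w: "w \<in> carrier R" "w' \<in> carrier R" "a = y \<otimes> w" "b = y \<otimes> w'"
      unfolding factor_def by auto
    have y: "y \<in> carrier R" "y \<otimes> a = \<zero>" using that by (auto simp: P_def)
    \<comment> \<open>By regularity relative to the pair \<open>w\<close>, \<open>w'\<close>, the element \<open>y\<close> kills \<open>w\<close> or is regular;
      but \<open>y w = a \<noteq> 0\<close> and \<open>y a = 0\<close>.\<close>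
    have "incomparable w w'"
      using ab w y divides_mult_lI[of w w' y] divides_mult_lI[of w' w y] by auto
    from regular[OF this y(1), of a] w(3) ab y nz[OF ab] have False by auto
    then show ?thesis ..
  qed
  moreover have "(\<forall>z\<in>carrier R. c \<otimes> z = \<zero> \<longrightarrow> z = \<zero>) \<and> (\<forall>z\<in>P. c divides z) \<and>
         (\<forall>z\<in>carrier R. c divides z \<or> z divides c)" if c: "c \<in> carrier R - P" for c
  proof -
    have reg: "z = \<zero>" if "z \<in> carrier R" "c \<otimes> z = \<zero>" for z
      using regular[OF ab _ _ that] c by (auto simp: P_def)
    have "c \<noteq> \<zero>" using c ab by (auto simp: P_def)
    then have comp: "c divides z \<or> z divides c" if "z \<in> carrier R" for z
      using sq[of c z] reg[of c] that c by blast
    have "c divides z" if z: "z \<in> P" for z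
    proof (rule ccontr)
      assume "\<not> c divides z"
      then have "z divides c" using comp z by (auto simp: P_def)
      then obtain r where "r \<in> carrier R" "c = z \<otimes> r" by (auto elim: dividesE)
      then show False using c ideal.I_r_closed[OF P z] by simp
    qed
    then show ?thesis using reg comp by blast
  qed
  ultimately show ?thesis using P unfolding sq_zero_divisible_def by blast
qed simp

section \<open>Finitely presented ideals\<close>

definition annihilator :: "'a \<Rightarrow> 'a set" where
  "annihilator b = {z \<in> carrier R. z \<otimes> b = \<zero>}"

lemma annihilator_ideal:
  assumes b: "b \<in> carrier R"
  shows "ideal (annihilator b) R"
proof (rule idealI[OF ring_axioms])
  show "subgroup (annihilator b) (add_monoid R)"
    using b by (intro add.subgroupI) (auto simp: annihilator_def l_distr l_minus)
  fix x y assume x: "x \<in> annihilator b" and y: "y \<in> carrier R"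
  have "y \<otimes> x \<otimes> b = y \<otimes> (x \<otimes> b)" using x y b by (simp add: annihilator_def m_assoc)
  then show *: "y \<otimes> x \<in> annihilator b" using x y by (simp add: annihilator_def)
  then show "x \<otimes> y \<in> annihilator b" using x y m_comm[of x y] by (simp add: annihilator_def)
qed

lemma annihilator_zero: "annihilator \<zero> = carrier R"
  and annihilator_one: "annihilator \<one> = {\<zero>}"
  by (auto simp: annihilator_def)

lemma PIdl_zero: "PIdl \<zero> = {\<zero>}" and PIdl_one: "PIdl \<one> = carrier R"
  by (force simp: cgenideal_def)+

lemma principal_cover:
  assumes b: "b \<in> carrier R"
  shows "(\<lambda>c. c 0 \<otimes> b) \<in> module_hom R (fvec R {0}) (ideal_module R (PIdl b))"
    and "(\<lambda>c. c 0 \<otimes> b) ` carrier (fvec R {0}) = carrier (ideal_module R (PIdl b))"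
proof -
  show "(\<lambda>c. c 0 \<otimes> b) \<in> module_hom R (fvec R {0}) (ideal_module R (PIdl b))"
    using b by (intro module_homI) (auto simp: fvec_simps ideal_module_simps cgenideal_def l_distr m_assoc)
  have "r \<otimes> b \<in> (\<lambda>c. c 0 \<otimes> b) ` carrier (fvec R {0})" if "r \<in> carrier R" for r
    using that by (intro image_eqI[of _ _ "\<lambda>i. if i = 0 then r else \<zero>"]) (auto simp: fvec_simps)
  then show "(\<lambda>c. c 0 \<otimes> b) ` carrier (fvec R {0}) = carrier (ideal_module R (PIdl b))"
    by (auto simp: ideal_module_simps cgenideal_def fvec_simps)
qed

lemma fin_gen_principal:
  assumes b: "b \<in> carrier R"
  shows "fin_gen R (ideal_module R (PIdl b))"
  by (rule fin_gen_image[OF module_fvec module_ideal_module[OF cgenideal_ideal[OF b]]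
        principal_cover[OF b] fin_gen_fvec]) simp

text \<open>\<open>Rb\<close> is \<open>R / ann b\<close>.\<close>

lemma fin_pres_principal:
  assumes b: "b \<in> carrier R" and fg: "fin_gen R (ideal_module R (annihilator b))"
  shows "fin_pres (ideal_module R (PIdl b))"
proof -
  let ?p = "\<lambda>c :: nat \<Rightarrow> 'a. c 0 \<otimes> b" and ?I = "ideal_module R (PIdl b)"
  let ?i = "\<lambda>z i. if i = (0 :: nat) then z else \<zero>"
  note p = principal_cover[OF b]
  have mI: "module R ?I" by (rule module_ideal_module[OF cgenideal_ideal[OF b]])
  have "fin_gen R (ker_module (fvec R {0}) ?I ?p)"
  proof (rule fin_gen_image[OF _ _ _ _ fg])
    show "?i \<in> module_hom R (ideal_module R (annihilator b)) (ker_module (fvec R {0}) ?I ?p)"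
      by (intro module_homI)
         (auto simp: ideal_module_simps annihilator_def a_kernel_def' fvec_simps)
    have "c \<in> ?i ` annihilator b" if c: "c \<in> carrier (fvec R {0})" "c 0 \<otimes> b = \<zero>" for c
      using c by (intro image_eqI[of _ _ "c 0"]) (auto simp: annihilator_def fvec_simps)
    then show "?i ` carrier (ideal_module R (annihilator b)) = carrier (ker_module (fvec R {0}) ?I ?p)"
      by (auto simp: ideal_module_simps annihilator_def a_kernel_def' fvec_simps)
  qed (intro module_ker_module[OF module_fvec mI p(1)] module_ideal_module annihilator_ideal b)+
  then show ?thesis using p unfolding fin_pres_def by blast
qed

lemma fin_pres_zero_ideal: "fin_pres (ideal_module R {\<zero>})"
  using fin_pres_principal[OF zero_closed] fin_gen_principal[OF one_closed]
  by (simp add: annihilator_zero PIdl_zero PIdl_one)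

lemma fin_pres_reg_module: "fin_pres reg_module"
  using fin_pres_principal[OF one_closed] fin_gen_principal[OF zero_closed]
  by (simp add: annihilator_one PIdl_zero PIdl_one)

text \<open>Provides pivots. For \<open>P = {}\<close> this is the minimum of a finite set for a total divisibility order;
  in general the elements of \<open>P\<close> are divisible by all others and never need to be compared with
  each other.\<close>

lemma ex_common_divisor:
  assumes "finite S" "S \<subseteq> carrier R" "\<not> S \<subseteq> P"
    and comp: "\<And>c z. c \<in> carrier R - P \<Longrightarrow> z \<in> carrier R \<Longrightarrow> c divides z \<or> z divides c"
    and P: "\<And>c z. c \<in> carrier R - P \<Longrightarrow> z \<in> P \<Longrightarrow> c divides z"
  shows "\<exists>m\<in>S - P. \<forall>x\<in>S. m divides x"
  using assms(1-3)
proof (induction S rule: finite_induct)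
  case (insert x S)
  have refl: "y divides y" if "y \<in> carrier R" for y using that by (rule divides_refl)
  show ?case
  proof (cases "S \<subseteq> P")
    case True
    then have "x \<in> carrier R - P" using insert.prems by blast
    then show ?thesis using P refl[of x] True by blast
  next
    case False
    then obtain m where m: "m \<in> S - P" "\<forall>y\<in>S. m divides y" using insert by auto
    then have mc: "m \<in> carrier R - P" "x \<in> carrier R" using insert.prems by auto
    show ?thesis
    proof (cases "m divides x")
      case True
      then show ?thesis using m by blast
    next
      case False
      then have x: "x divides m" "x \<notin> P" using comp[OF mc] P[OF mc(1)] by blast+
      then have "\<forall>y\<in>S. x divides y" using m(2) mc by (meson divides_trans)
      then show ?thesis using x refl[OF mc(2)] by blast
    qed
  qed
qed simp

lemma PIdl_iff_divides: "b \<in> carrier R \<Longrightarrow> x \<in> PIdl b \<longleftrightarrow> b divides x"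
  by (auto simp: cgenideal_def factor_def m_comm)

lemma fin_gen_ideal_chain_ring:
  assumes chain: "\<And>a b. a \<in> carrier R \<Longrightarrow> b \<in> carrier R \<Longrightarrow> a divides b \<or> b divides a"
    and I: "ideal I R" and fg: "fin_gen R (ideal_module R I)"
  shows "\<exists>b\<in>carrier R. I = PIdl b"
proof -
  interpret I: ideal I R by (rule I)
  obtain B where B: "finite B" "generates R (ideal_module R I) B" using fg by (auto simp: fin_gen_def)
  have BI: "B \<subseteq> I" using B(2) by (auto simp: generates_def ideal_module_simps)
  have "insert \<zero> B \<subseteq> carrier R" "finite (insert \<zero> B)" using BI I.Icarr B(1) by auto
  from ex_common_divisor[OF this(2,1), of "{}"] chain
  obtain b where b: "b \<in> insert \<zero> B" "\<forall>x\<in>insert \<zero> B. b divides x" by auto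
  have bI: "b \<in> I" using b(1) BI by auto
  have bc: "b \<in> carrier R" using I.Icarr[OF bI] .
  have "PIdl b \<subseteq> I" using cgenideal_minimal[OF I bI] .
  then have "submodule (PIdl b) R (ideal_module R I)"
    by (intro submodule_ideal_module[OF I cgenideal_ideal[OF bc] _ module_ideal_module[OF I]])
  moreover have "B \<subseteq> PIdl b" using b(2) PIdl_iff_divides[OF bc] by blast
  ultimately have "I \<subseteq> PIdl b" using B(2) by (auto simp: generates_def ideal_module_simps)
  then show ?thesis using \<open>PIdl b \<subseteq> I\<close> bc by blast
qed

text \<open>In fact \<open>ann b = Ra\<close> unless \<open>a\<close> or \<open>b\<close> is zero. If \<open>c \<in> ann b\<close> were not in \<open>Ra\<close>, then \<open>a = c r\<close> with a nonunit
  \<open>r\<close>. If \<open>r\<close> is a multiple of \<open>b\<close>, then \<open>a = 0\<close>. If \<open>b = r s\<close>, then \<open>s a = c b = 0\<close>, so \<open>s = t b\<close> and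
  \<open>(1 - r t) b = 0\<close>, whence \<open>b = 0\<close>.\<close>

lemma double_annihilator_chain_ring:
  assumes loc: "local_ring R"
    and chain: "\<And>a b. a \<in> carrier R \<Longrightarrow> b \<in> carrier R \<Longrightarrow> a divides b \<or> b divides a"
    and a: "a \<in> carrier R" and b: "b \<in> carrier R" and ann: "annihilator a = PIdl b"
  shows "\<exists>d\<in>carrier R. annihilator b = PIdl d"
proof (cases "a = \<zero> \<or> b = \<zero>")
  case True
  then show ?thesis
  proof
    assume "b = \<zero>"
    then show ?thesis using annihilator_zero PIdl_one by (intro bexI[of _ \<one>]) auto
  next
    assume "a = \<zero>"
    then have "\<one> \<in> PIdl b" using ann annihilator_zero by auto
    then obtain x where x: "x \<in> carrier R" "\<one> = x \<otimes> b" by (auto simp: cgenideal_def)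
    have "z = \<zero>" if "z \<in> annihilator b" for z
    proof -
      have z: "z \<in> carrier R" "z \<otimes> b = \<zero>" using that by (auto simp: annihilator_def)
      have "z = z \<otimes> (x \<otimes> b)" using z(1) x(2)[symmetric] by simp
      also have "\<dots> = x \<otimes> (z \<otimes> b)" using z(1) x(1) b by (intro m_lcomm)
      finally show ?thesis using z(2) x(1) by simp
    qed
    then have "annihilator b = PIdl \<zero>" using b by (auto simp: PIdl_zero annihilator_def)
    then show ?thesis by blast
  qed
next
  case False
  have "b \<in> annihilator a" using ann cgenideal_self[OF b] by simp
  then have ba: "b \<otimes> a = \<zero>" by (simp add: annihilator_def)
  have "annihilator b = PIdl a"
  proof
    show "PIdl a \<subseteq> annihilator b"
      using cgenideal_minimal[OF annihilator_ideal[OF b]] ba a b m_comm[of a b]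
      by (simp add: annihilator_def)
    show "annihilator b \<subseteq> PIdl a"
    proof
      fix c assume "c \<in> annihilator b"
      then have c: "c \<in> carrier R" "c \<otimes> b = \<zero>" by (auto simp: annihilator_def)
      show "c \<in> PIdl a"
      proof (rule ccontr)
        assume "c \<notin> PIdl a"
        then have nd: "\<not> a divides c" using PIdl_iff_divides[OF a] by simp
        then obtain r where r: "r \<in> carrier R" "a = c \<otimes> r"
          using chain[OF a c(1)] by (auto elim: dividesE)
        have rU: "r \<notin> Units R"
        proof
          assume "r \<in> Units R"
          then have "c = a \<otimes> inv r" "inv r \<in> carrier R" using r c by (simp_all add: m_assoc)
          then show False using nd by (auto intro: dividesI)
        qed
        consider s where "s \<in> carrier R" "b = r \<otimes> s" | s where "s \<in> carrier R" "r = b \<otimes> s"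
          using chain[OF b r(1)] by (auto elim: dividesE)
        then show False
        proof cases
          case (2 s)
          then have "a = (c \<otimes> b) \<otimes> s" using r(2) c(1) b by (simp add: m_assoc)
          then show False using c(2) 2 False by simp
        next
          case (1 s)
          have "s \<otimes> a = c \<otimes> b" using 1 r c(1) by (simp add: m_ac)
          then have "s \<in> PIdl b" using ann 1 c(2) by (auto simp: annihilator_def)
          then obtain t where t: "t \<in> carrier R" "s = t \<otimes> b" by (auto simp: cgenideal_def)
          interpret M: ideal "carrier R - Units R" R by (rule local_ring_nonunits[OF loc])
          have rt: "r \<otimes> t \<in> carrier R - Units R" using M.I_r_closed[OF _ t(1)] r rU by blast
          have "b = (r \<otimes> t) \<otimes> b" using 1(2) t r(1) b by (simp add: m_assoc)
          then have "(\<one> \<oplus> \<ominus> (r \<otimes> t)) \<otimes> b = \<zero>"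
            using rt b by (simp add: l_distr l_minus r_neg)
          moreover have "\<one> \<oplus> \<ominus> (r \<otimes> t) \<in> Units R"
          proof (rule ccontr)
            assume "\<one> \<oplus> \<ominus> (r \<otimes> t) \<notin> Units R"
            then have "(\<one> \<oplus> \<ominus> (r \<otimes> t)) \<oplus> r \<otimes> t \<in> carrier R - Units R"
              by (intro M.a_closed rt DiffI a_closed a_inv_closed one_closed DiffD1[OF rt])
            moreover have "(\<one> \<oplus> \<ominus> (r \<otimes> t)) \<oplus> r \<otimes> t = \<one>"
              using DiffD1[OF rt] by (simp only: a_assoc l_neg r_zero one_closed a_inv_closed)
            ultimately show False by simp
          qed
          ultimately have "b = \<zero>" using b Units_l_cancel[of "\<one> \<oplus> \<ominus> (r \<otimes> t)" b \<zero>] Units_closed by simp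
          then show False using False by simp
        qed
      qed
    qed
  qed
  then show ?thesis using a by blast
qed

lemma fin_pres_annihilator_chain_ring:
  assumes loc: "local_ring R"
    and chain: "\<And>a b. a \<in> carrier R \<Longrightarrow> b \<in> carrier R \<Longrightarrow> a divides b \<or> b divides a"
    and a: "a \<in> carrier R" and fg: "fin_gen R (ideal_module R (annihilator a))"
  shows "fin_pres (ideal_module R (annihilator a))"
proof -
  obtain b where b: "b \<in> carrier R" "annihilator a = PIdl b"
    using fin_gen_ideal_chain_ring[OF chain annihilator_ideal[OF a] fg] by blast
  obtain d where d: "d \<in> carrier R" "annihilator b = PIdl d"
    using double_annihilator_chain_ring[OF loc chain a b] by blast
  show ?thesis using fin_pres_principal[OF b(1)] fin_gen_principal[OF d(1)] b d by simp
qed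

definition vec_ideal :: "nat set \<Rightarrow> 'a set \<Rightarrow> ('a, nat \<Rightarrow> 'a) module" where
  "vec_ideal J P = (fvec R J)\<lparr>carrier := {c \<in> carrier (fvec R J). \<forall>i. c i \<in> P}\<rparr>"

lemma module_vec_ideal:
  assumes P: "ideal P R"
  shows "module R (vec_ideal J P)"
proof -
  interpret P: ideal P R by (rule P)
  interpret F: module R "fvec R J" by (rule module_fvec)
  have minus: "\<ominus>\<^bsub>fvec R J\<^esub> c = (\<lambda>i. \<ominus> c i)" if c: "c \<in> carrier (fvec R J)" for c
  proof -
    have "\<ominus>\<^bsub>fvec R J\<^esub> c = (\<ominus> \<one>) \<odot>\<^bsub>fvec R J\<^esub> c"
      using F.smult_l_minus[OF one_closed c] F.smult_one[OF c] by simp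
    also have "\<dots> = (\<lambda>i. \<ominus> c i)" using c by (auto simp: fvec_simps l_minus)
    finally show ?thesis .
  qed
  have "submodule {c \<in> carrier (fvec R J). \<forall>i. c i \<in> P} R (fvec R J)"
    by (intro F.submoduleI) (auto simp: minus, auto simp: fvec_simps P.I_l_closed)
  from submodule.submodule_is_module[OF this module_fvec] show ?thesis by (simp add: vec_ideal_def)
qed

lemma fin_gen_vec_ideal:
  assumes P: "ideal P R" and fg: "fin_gen R (ideal_module R P)" and J: "finite J"
  shows "fin_gen R (vec_ideal J P)"
  using J
proof (induction J rule: finite_induct)
  case empty
  have "carrier (vec_ideal {} P) = {\<zero>\<^bsub>vec_ideal {} P\<^esub>}"
    using additive_subgroup.zero_closed[OF ideal.axioms(1)[OF P]]
    by (auto simp: vec_ideal_def fvec_simps)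
  then show ?case by (rule fin_gen_trivial[OF module_vec_ideal[OF P]])
next
  case (insert q J)
  interpret P: ideal P R by (rule P)
  let ?i = "\<lambda>z i. if i = q then z else \<zero>"
  show ?case
  proof (rule fin_gen_sum[OF _ _ _ _ _ _ insert.IH fg])
    show "(\<lambda>c. c) \<in> module_hom R (vec_ideal J P) (vec_ideal (insert q J) P)"
      by (rule module_homI) (auto simp: vec_ideal_def fvec_simps)
    show "?i \<in> module_hom R (ideal_module R P) (vec_ideal (insert q J) P)"
      using P.Icarr by (intro module_homI) (auto simp: vec_ideal_def fvec_simps ideal_module_simps)
    fix w assume "w \<in> carrier (vec_ideal (insert q J) P)"
    then have w: "w i \<in> carrier R" "w i \<in> P" "i \<notin> insert q J \<Longrightarrow> w i = \<zero>" for i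
      by (auto simp: vec_ideal_def fvec_simps)
    show "\<exists>x\<in>carrier (vec_ideal J P). \<exists>y\<in>carrier (ideal_module R P).
        w = x \<oplus>\<^bsub>vec_ideal (insert q J) P\<^esub> ?i y"
      using w by (intro bexI[of _ "w(q := \<zero>)"] bexI[of _ "w q"])
        (auto simp: vec_ideal_def fvec_simps ideal_module_simps fun_eq_iff)
  qed (intro module_vec_ideal module_ideal_module P)+
qed

lemma submodule_hom_image:
  assumes V: "module R V" and W: "module R W" and f: "f \<in> module_hom R V W"
  shows "submodule (f ` carrier V) R W"
proof -
  interpret V: module R V by (rule V)
  interpret W: module R W by (rule W)
  show ?thesis
  proof (rule W.submoduleI)
    show "f ` carrier V \<subseteq> carrier W" using module_hom_closed[OF f] by blast
    show "\<zero>\<^bsub>W\<^esub> \<in> f ` carrier V"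
      by (rule image_eqI[where f = f, OF module_hom_zero[OF V W f, symmetric] V.zero_closed])
    fix v assume "v \<in> f ` carrier V"
    then obtain c where c: "c \<in> carrier V" "v = f c" by blast
    show "\<ominus>\<^bsub>W\<^esub> v \<in> f ` carrier V"
      unfolding c(2) by (rule image_eqI[where f = f, OF module_hom_minus[OF V W f c(1), symmetric] V.a_inv_closed[OF c(1)]])
    show "r \<odot>\<^bsub>W\<^esub> v \<in> f ` carrier V" if r: "r \<in> carrier R" for r
      unfolding c(2) by (rule image_eqI[where f = f, OF module_hom_smult[OF f r c(1), symmetric] V.smult_closed[OF r c(1)]])
    fix w assume "w \<in> f ` carrier V"
    then obtain d where d: "d \<in> carrier V" "w = f d" by blast
    show "v \<oplus>\<^bsub>W\<^esub> w \<in> f ` carrier V"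
      unfolding c(2) d(2) by (rule image_eqI[where f = f, OF module_hom_add[OF f c(1) d(1), symmetric] V.a_closed[OF c(1) d(1)]])
  qed
qed

lemma finite_generators_cover:
  assumes M: "module R M" and J: "finite J" and x: "x \<in> J \<rightarrow> carrier M"
    and gen: "generates R M (x ` J)"
  shows "lincomb J M x ` carrier (fvec R J) = carrier M"
proof
  interpret M: module R M by (rule M)
  interpret F: module R "fvec R J" by (rule module_fvec)
  note L = lincomb_hom[OF M J x]
  let ?L = "lincomb J M x"
  show "?L ` carrier (fvec R J) \<subseteq> carrier M" using module_hom_closed[OF L] by blast
  have "submodule (?L ` carrier (fvec R J)) R M" by (rule submodule_hom_image[OF module_fvec M L])
  moreover have "x ` J \<subseteq> ?L ` carrier (fvec R J)"
    using lincomb_unit_vec[OF M J x, symmetric] unit_vec_closed by (intro image_subsetI image_eqI) 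
  ultimately show "carrier M \<subseteq> ?L ` carrier (fvec R J)" using gen by (simp add: generates_def)
qed

text \<open>Take a generating set \<open>h\<^sub>1, \<dots>, h\<^sub>k\<close> of \<open>P\<close> with least \<open>k\<close> and a relation \<open>\<Sum> c\<^sub>i h\<^sub>i = 0\<close>. If \<open>c\<^sub>j\<close> is not
  in \<open>P\<close>, write \<open>h\<^sub>j = c\<^sub>j z\<close>; then \<open>z \<in> P\<close>, say \<open>z = \<Sum> r\<^sub>i h\<^sub>i\<close>, so that
  \<open>h\<^sub>j = \<Sum> c\<^sub>j r\<^sub>i h\<^sub>i\<close>. The term with \<open>i = j\<close> is a multiple of \<open>c\<^sub>j h\<^sub>j\<close>, which the relation expresses
  by the other generators. So \<open>h\<^sub>j\<close> is superfluous, against minimality. Conversely \<open>P\<^sup>2 = 0\<close> makes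
  every vector over \<open>P\<close> a relation. The module of relations is therefore \<open>P\<^sup>k\<close>, finitely generated.\<close>

lemma fin_pres_sq_zero_divisible:
  assumes sz: "sq_zero_divisible P" and fg: "fin_gen R (ideal_module R P)"
  shows "fin_pres (ideal_module R P)"
proof -
  let ?V = "ideal_module R P"
  have P: "ideal P R" and sq: "\<And>x y. x \<in> P \<Longrightarrow> y \<in> P \<Longrightarrow> x \<otimes> y = \<zero>"
    and reg: "\<And>c z. c \<in> carrier R - P \<Longrightarrow> z \<in> carrier R \<Longrightarrow> c \<otimes> z = \<zero> \<Longrightarrow> z = \<zero>"
    and dvd: "\<And>c z. c \<in> carrier R - P \<Longrightarrow> z \<in> P \<Longrightarrow> c divides z"
    using sz unfolding sq_zero_divisible_def by blast+
  interpret P: ideal P R by (rule P)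
  have V: "module R ?V" by (rule module_ideal_module[OF P])
  interpret V: module R ?V by (rule V)
  obtain B0 where "finite B0 \<and> generates R ?V B0" using fg by (auto simp: fin_gen_def)
  then obtain B where B: "finite B" "generates R ?V B"
    and min: "\<And>B'. finite B' \<Longrightarrow> generates R ?V B' \<Longrightarrow> card B \<le> card B'"
    using ex_has_least_nat[of "\<lambda>B. finite B \<and> generates R ?V B" B0 card] by blast
  obtain h where h: "bij_betw h {..<card B} B"
    using ex_bij_betw_nat_finite[OF B(1)] by (auto simp: atLeast0LessThan)
  define J where "J = {..<card B}"
  have J: "finite J" and hB: "h ` J = B" and inj: "inj_on h J"
    using h by (auto simp: J_def bij_betw_def)
  have BP: "B \<subseteq> P" using B(2) by (auto simp: generates_def ideal_module_simps)
  have hJ: "h \<in> J \<rightarrow> carrier ?V" using hB BP by (auto simp: ideal_module_simps)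
  have hP: "h j \<in> P" if "j \<in> J" for j using that hB BP by blast
  define p where "p = lincomb J ?V h"
  have p: "p \<in> module_hom R (fvec R J) ?V" unfolding p_def by (rule lincomb_hom[OF V J hJ])
  have surj: "p ` carrier (fvec R J) = carrier ?V"
    unfolding p_def using finite_generators_cover[OF V J hJ] hB B(2) by simp
  have p_unit: "p (unit_vec R j) = h j" if "j \<in> J" for j
    unfolding p_def by (rule lincomb_unit_vec[OF V J hJ that])
  have p_split: "p c = p (c(j := \<zero>)) \<oplus> c j \<otimes> h j" if c: "c \<in> carrier (fvec R J)" and j: "j \<in> J" for c j
  proof -
    have cj: "c i \<in> carrier R" for i using c by (simp add: fvec_simps)
    have 1: "c(j := \<zero>) \<in> carrier (fvec R J)" using c by (auto simp: fvec_simps)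
    have 2: "c j \<odot>\<^bsub>fvec R J\<^esub> unit_vec R j \<in> carrier (fvec R J)"
      using c j by (auto simp: fvec_simps unit_vec_def)
    have "c = c(j := \<zero>) \<oplus>\<^bsub>fvec R J\<^esub> (c j \<odot>\<^bsub>fvec R J\<^esub> unit_vec R j)"
      using cj by (auto simp: fvec_simps unit_vec_def)
    then have "p c = p (c(j := \<zero>)) \<oplus>\<^bsub>?V\<^esub> p (c j \<odot>\<^bsub>fvec R J\<^esub> unit_vec R j)"
      using module_hom_add[OF p 1 2] by simp
    then show ?thesis
      using module_hom_smult[OF p cj unit_vec_closed[OF j]] p_unit[OF j] by (simp add: ideal_module_simps)
  qed
  have ker_P: "c j \<in> P" if c: "c \<in> carrier (fvec R J)" "p c = \<zero>" for c j
  proof (rule ccontr)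
    assume cjP: "c j \<notin> P"
    then have cj: "c j \<in> carrier R - P" using c by (simp add: fvec_simps)
    have j: "j \<in> J" using c(1) cjP P.zero_closed by (metis fvec_simps(1))
    have hj: "h j \<in> carrier R" using hP[OF j] P.Icarr by blast
    obtain z where z: "z \<in> carrier R" "h j = c j \<otimes> z" using dvd[OF cj hP[OF j]] by (auto elim: dividesE)
    have zP: "z \<in> P"
    proof (rule ccontr)
      assume "z \<notin> P"
      have "c j \<otimes> (z \<otimes> h j) = h j \<otimes> h j" using z cj hj by (simp add: m_assoc)
      also have "\<dots> = \<zero>" using sq hP[OF j] by blast
      finally have "z \<otimes> h j = \<zero>" using reg[OF cj, of "z \<otimes> h j"] z(1) hj by simp
      then have "h j = \<zero>" using reg[of z "h j"] \<open>z \<notin> P\<close> z(1) hj by simp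
      then have "z = \<zero>" using reg[OF cj z(1)] z(2) by simp
      then show False using \<open>z \<notin> P\<close> by simp
    qed
    obtain r where r: "r \<in> carrier (fvec R J)" "p r = z" using zP surj by (auto simp: ideal_module_simps)
    have rj: "r j \<in> carrier R" using r(1) by (simp add: fvec_simps)
    have "generates R ?V (B - {h j})"
      unfolding generates_def
    proof (intro conjI allI impI)
      show "B - {h j} \<subseteq> carrier ?V" using BP by (auto simp: ideal_module_simps)
      fix U assume U: "submodule U R ?V" "B - {h j} \<subseteq> U"
      note Ucl = V.submoduleE[OF U(1), unfolded ideal_module_simps]
      have pU: "p (d(j := \<zero>)) \<in> U" if d: "d \<in> carrier (fvec R J)" for d
      proof -
        have sub: "e \<in> carrier (fvec R (J - {j})) \<Longrightarrow> e \<in> carrier (fvec R J)" for e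
          by (auto simp: fvec_simps)
        have p': "p \<in> module_hom R (fvec R (J - {j})) ?V"
          using module_hom_closed[OF p] module_hom_add[OF p] module_hom_smult[OF p] sub
          by (intro module_homI) (simp_all add: fvec_simps(3,4))
        have "unit_vec R i \<in> {e \<in> carrier (fvec R (J - {j})). p e \<in> U}" if i: "i \<in> J - {j}" for i
        proof -
          have "h i \<noteq> h j" using i j inj by (auto simp: inj_on_def)
          then show ?thesis using i p_unit U(2) hB unit_vec_closed[OF i] by auto
        qed
        moreover have "d(j := \<zero>) \<in> carrier (fvec R (J - {j}))" using d by (auto simp: fvec_simps)
        ultimately show ?thesis
          using unit_vecs_generate[OF _ submodule_vimage[OF module_fvec V p' U(1)]] J by blast
      qed
      have "p (c(j := \<zero>)) \<in> carrier R" using pU[OF c(1)] Ucl(1) P.Icarr by blast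
      then have "c j \<otimes> h j = \<ominus> p (c(j := \<zero>))"
        using p_split[OF c(1) j] c(2) cj hj minus_equality[of "c j \<otimes> h j" "p (c(j := \<zero>))"]
        by (simp add: a_comm)
      also have "\<dots> = (\<ominus> \<one>) \<otimes> p (c(j := \<zero>))" using \<open>p (c(j := \<zero>)) \<in> carrier R\<close> by (simp add: l_minus)
      also have "\<dots> \<in> U" using Ucl(4) pU[OF c(1)] by simp
      finally have cjh: "c j \<otimes> h j \<in> U" .
      define s where "s = p (r(j := \<zero>))"
      have s: "s \<in> U" unfolding s_def by (rule pU[OF r(1)])
      have sc: "s \<in> carrier R" using s Ucl(1) P.Icarr by blast
      have "h j = c j \<otimes> (s \<oplus> r j \<otimes> h j)" using z(2) r(2) p_split[OF r(1) j] by (simp add: s_def)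
      also have "\<dots> = c j \<otimes> s \<oplus> r j \<otimes> (c j \<otimes> h j)"
        using cj sc rj hj by (simp add: r_distr m_lcomm)
      also have "\<dots> \<in> U" using Ucl(4,5) cj s rj cjh by blast
      finally have "B \<subseteq> U" using U(2) by blast
      then show "carrier ?V \<subseteq> U" using B(2) U(1) by (simp add: generates_def)
    qed
    from min[OF _ this] B(1) have "card B \<le> card (B - {h j})" by simp
    moreover have "h j \<in> B" using j hB by blast
    ultimately show False using B(1) by (metis card_Diff1_less not_le)
  qed
  have p_sq: "p c = \<zero>" if c: "c \<in> carrier (fvec R J)" "\<And>i. c i \<in> P" for c
  proof -
    have "p c = (\<Oplus>\<^bsub>?V\<^esub>j\<in>J. c j \<odot>\<^bsub>?V\<^esub> h j)" by (simp add: p_def lincomb_def)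
    also have "\<dots> = (\<Oplus>\<^bsub>?V\<^esub>j\<in>J. \<zero>\<^bsub>?V\<^esub>)"
      using c(2) hP sq by (intro V.finsum_cong') (auto simp: ideal_module_simps)
    also have "\<dots> = \<zero>\<^bsub>?V\<^esub>" by (rule V.finsum_zero)
    finally show ?thesis by (simp add: ideal_module_simps)
  qed
  have "a_kernel (fvec R J) ?V p = {c \<in> carrier (fvec R J). \<forall>i. c i \<in> P}"
    using ker_P p_sq by (auto simp: a_kernel_def' ideal_module_simps)
  then have "ker_module (fvec R J) ?V p = vec_ideal J P" by (simp add: vec_ideal_def)
  then have "fin_gen R (ker_module (fvec R J) ?V p)" using fin_gen_vec_ideal[OF P fg J] by simp
  then show ?thesis using J p surj unfolding fin_pres_def by blast
qed

section \<open>Kernels of matrices\<close>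

text \<open>The data of one elimination step on \<open>A\<close>, which removes the coordinate \<open>q\<close> and splits the
  ideal \<open>I\<close> off the kernel.\<close>

definition splitting :: "nat set \<Rightarrow> ('a, 'm) module \<Rightarrow> ((nat \<Rightarrow> 'a) \<Rightarrow> 'm) \<Rightarrow> nat \<Rightarrow> 'a set \<Rightarrow> bool" where
  "splitting J W A q I \<longleftrightarrow> q \<in> J \<and> ideal I R \<and>
     (\<exists>g\<in>carrier (fvec R J). \<exists>u\<in>module_hom R (fvec R J) reg_module. g q = \<one> \<and> u g = \<one> \<and>
       (\<forall>c\<in>carrier (fvec R J). A c = \<zero>\<^bsub>W\<^esub> \<longrightarrow> u c \<in> I) \<and>
       (\<forall>z\<in>I. z \<odot>\<^bsub>W\<^esub> A g = \<zero>\<^bsub>W\<^esub>))"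

text \<open>Elimination of one coordinate at a time. Finite generation passes to both summands of the
  kernel, finite presentation is assembled from both.\<close>

lemma kernel_fin_pres_induct:
  assumes W: "module R W"
    and split: "\<And>J A. finite J \<Longrightarrow> J \<noteq> {} \<Longrightarrow> A \<in> module_hom R (fvec R J) W \<Longrightarrow>
      \<exists>q I. splitting J W A q I \<and> (fin_gen R (ideal_module R I) \<longrightarrow> fin_pres (ideal_module R I))"
    and J: "finite J" and A: "A \<in> module_hom R (fvec R J) W"
    and fg: "fin_gen R (ker_module (fvec R J) W A)"
  shows "fin_pres (ker_module (fvec R J) W A)"
  using J A fg
proof (induction "card J" arbitrary: J A)
  case 0
  then have J: "J = {}" by simp
  let ?K = "ker_module (fvec R {}) W A"
  have A: "A \<in> module_hom R (fvec R {}) W" using 0 J by simp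
  have K: "module R ?K" by (rule module_ker_module[OF module_fvec W A])
  have c0: "carrier (fvec R {}) = {\<lambda>i. \<zero>}" by (auto simp: fvec_simps)
  have cK: "carrier ?K = {\<lambda>i. \<zero>}"
    using submodule_zero_mem[OF submodule_kernel[OF module_fvec W A]] c0
    by (auto simp: a_kernel_def' fvec_simps(2))
  have id: "(\<lambda>c. c) \<in> module_hom R (fvec R {}) ?K" using c0 cK by (intro module_homI) auto
  have "fin_gen R (ker_module (fvec R {}) ?K (\<lambda>c. c))"
    by (rule fin_gen_trivial[OF module_ker_module[OF module_fvec K id]])
       (use c0 in \<open>auto simp: a_kernel_def' fvec_simps(2)\<close>)
  then have "fin_pres ?K"
    unfolding fin_pres_def using id c0 cK by (intro exI[of _ "{}"] exI[of _ "\<lambda>c. c"]) simp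
  then show ?case using J by simp
next
  case (Suc n)
  then have "J \<noteq> {}" by auto
  from split[OF Suc.prems(1) this Suc.prems(2)] obtain q I where q: "splitting J W A q I"
    and fp: "fin_gen R (ideal_module R I) \<Longrightarrow> fin_pres (ideal_module R I)" by blast
  from q obtain g u where qJ: "q \<in> J" and I: "ideal I R" and g: "g \<in> carrier (fvec R J)" "g q = \<one>"
    and u: "u \<in> module_hom R (fvec R J) reg_module" "u g = \<one>"
    and uI: "\<And>c. c \<in> carrier (fvec R J) \<Longrightarrow> A c = \<zero>\<^bsub>W\<^esub> \<Longrightarrow> u c \<in> I"
    and Ig: "\<And>z. z \<in> I \<Longrightarrow> z \<odot>\<^bsub>W\<^esub> A g = \<zero>\<^bsub>W\<^esub>"
    unfolding splitting_def by blast
  from kernel_biproduct[OF W Suc.prems(2) qJ g u I uI Ig]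
  obtain A' where A': "A' \<in> module_hom R (fvec R (J - {q})) W"
    and bp: "biproduct R (ker_module (fvec R J) W A) (ker_module (fvec R (J - {q})) W A')
      (ideal_module R I)" ..
  have "n = card (J - {q})" using Suc.hyps(2) Suc.prems(1) qJ by simp
  from Suc.hyps(1)[OF this _ A' biproduct_fin_gen(1)[OF bp Suc.prems(3)]] Suc.prems(1)
  have "fin_pres (ker_module (fvec R (J - {q})) W A')" by simp
  from biproduct_fin_pres[OF bp this fp[OF biproduct_fin_gen(2)[OF bp Suc.prems(3)]]] show ?case .
qed

lemma coordinate_hom: "(\<lambda>c. c q) \<in> module_hom R (fvec R J) reg_module"
  by (rule module_homI) (auto simp: fvec_simps ideal_module_simps)

lemma splitting_kernel_vector:
  assumes W: "module R W" and q: "q \<in> J"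
    and g: "g \<in> carrier (fvec R J)" "g q = \<one>" "A g = \<zero>\<^bsub>W\<^esub>"
  shows "splitting J W A q (carrier R)"
proof -
  interpret W: module R W by (rule W)
  show ?thesis unfolding splitting_def
    using q g coordinate_hom[of q J] oneideal by (auto simp: fvec_simps intro!: bexI[of _ g])
qed

text \<open>The splitting along the standard basis: the \<open>q\<close>-th coordinates of kernel vectors lie in an ideal that
  annihilates the \<open>q\<close>-th column.\<close>

lemma splitting_annihilated:
  assumes q: "q \<in> J" and I: "ideal I R"
    and ker: "\<And>c. c \<in> carrier (fvec R J) \<Longrightarrow> A c = \<zero>\<^bsub>W\<^esub> \<Longrightarrow> c q \<in> I"
    and ann: "\<And>z. z \<in> I \<Longrightarrow> z \<odot>\<^bsub>W\<^esub> A (unit_vec R q) = \<zero>\<^bsub>W\<^esub>"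
  shows "splitting J W A q I"
  unfolding splitting_def
  using assms coordinate_hom unit_vec_closed[OF q]
  by (intro conjI bexI[of _ "unit_vec R q"] bexI[of _ "\<lambda>c. c q"]) (auto simp: unit_vec_def[of R q])

text \<open>Write \<open>a\<close> for the pivot in row \<open>p\<close>. That row is \<open>a u\<close> for the linear form \<open>u\<close> of quotients, with
  coefficient \<open>1\<close> at \<open>q\<close>. A kernel vector \<open>c\<close> satisfies \<open>a u(c) = 0\<close>, and \<open>ann a\<close> annihilates the
  whole column \<open>q\<close>, as \<open>a\<close> divides it. The column operations of this elimination
  also turn row \<open>p\<close> into zero.\<close>

lemma splitting_pivot:
  assumes J: "finite J" and A: "A \<in> module_hom R (fvec R J) (fvec R L)" and q: "q \<in> J"
    and pivot: "\<And>j i. j \<in> J \<Longrightarrow> A (unit_vec R q) p divides A (unit_vec R j) i"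
  shows "splitting J (fvec R L) A q (annihilator (A (unit_vec R q) p))"
proof -
  define a where "a = A (unit_vec R q) p"
  have entry: "A (unit_vec R j) i \<in> carrier R" if "j \<in> J" for j i
    using module_hom_closed[OF A unit_vec_closed[OF that]] by (simp add: fvec_simps)
  have a: "a \<in> carrier R" unfolding a_def by (rule entry[OF q])
  \<comment> \<open>Quotients by the pivot are not unique if it is a zero divisor; at \<open>q\<close> the choice has to be \<open>1\<close>.\<close>
  define t where "t = (\<lambda>j. if j = q then \<one> else SOME t. t \<in> carrier R \<and> A (unit_vec R j) p = a \<otimes> t)"
  have t: "t j \<in> carrier R \<and> a \<otimes> t j = A (unit_vec R j) p" if j: "j \<in> J" for j
  proof (cases "j = q")
    case False
    have "\<exists>t. t \<in> carrier R \<and> A (unit_vec R j) p = a \<otimes> t"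
      using pivot[OF j, of p] by (auto simp: a_def elim: dividesE)
    from someI_ex[OF this] show ?thesis using False by (simp add: t_def)
  qed (use a in \<open>simp add: t_def a_def\<close>)
  have tJ: "t \<in> J \<rightarrow> carrier reg_module" using t by (simp add: ideal_module_simps)
  define u where "u = lincomb J reg_module t"
  have u: "u \<in> module_hom R (fvec R J) reg_module"
    unfolding u_def by (rule lincomb_hom[OF module_reg_module J tJ])
  have u_unit: "u (unit_vec R j) = t j" if "j \<in> J" for j
    unfolding u_def by (rule lincomb_unit_vec[OF module_reg_module J tJ that])
  have uc: "u c \<in> carrier R" if "c \<in> carrier (fvec R J)" for c
    using module_hom_closed[OF u that] by (simp add: ideal_module_simps)
  have au: "a \<otimes> u c = A c p" if c: "c \<in> carrier (fvec R J)" for c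
  proof (rule fvec_hom_eqI[OF J module_reg_module _ _ _ c])
    have "(\<lambda>x. a \<otimes> x) \<in> module_hom R reg_module reg_module"
      using a by (intro module_homI) (auto simp: ideal_module_simps r_distr m_lcomm)
    from module_hom_comp[OF u this] show "(\<lambda>c. a \<otimes> u c) \<in> module_hom R (fvec R J) reg_module" .
    have "(\<lambda>c. c p) \<in> module_hom R (fvec R L) reg_module" by (rule coordinate_hom)
    from module_hom_comp[OF A this] show "(\<lambda>c. A c p) \<in> module_hom R (fvec R J) reg_module" .
  qed (use t u_unit in simp)
  have "z \<odot>\<^bsub>fvec R L\<^esub> A (unit_vec R q) = \<zero>\<^bsub>fvec R L\<^esub>" if z: "z \<in> annihilator a" for z
  proof -
    have "z \<otimes> A (unit_vec R q) i = \<zero>" for i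
    proof -
      obtain v where "v \<in> carrier R" "A (unit_vec R q) i = a \<otimes> v"
        using pivot[OF q, of i] by (auto simp: a_def elim: dividesE)
      then show ?thesis using z a by (simp add: annihilator_def m_assoc[symmetric])
    qed
    then show ?thesis by (simp add: fvec_simps)
  qed
  moreover have "u c \<in> annihilator a" if c: "c \<in> carrier (fvec R J)" "A c = \<zero>\<^bsub>fvec R L\<^esub>" for c
    using au[OF c(1)] c(2) uc[OF c(1)] a by (simp add: annihilator_def fvec_simps m_comm)
  moreover have "u (unit_vec R q) = \<one>" using u_unit[OF q] by (simp add: t_def)
  ultimately show ?thesis
    unfolding splitting_def a_def[symmetric]
    using q annihilator_ideal[OF a] u unit_vec_closed[OF q]
    by (intro conjI bexI[of _ "unit_vec R q"] bexI[of _ u]) (auto simp: unit_vec_def)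
qed

lemma ex_pivot:
  assumes J: "finite J" and L: "finite L" and A: "A \<in> module_hom R (fvec R J) (fvec R L)"
    and j: "j \<in> J" "i \<in> L" "A (unit_vec R j) i \<notin> P"
    and comp: "\<And>c z. c \<in> carrier R - P \<Longrightarrow> z \<in> carrier R \<Longrightarrow> c divides z \<or> z divides c"
    and P: "\<And>c z. c \<in> carrier R - P \<Longrightarrow> z \<in> P \<Longrightarrow> c divides z"
  shows "\<exists>q\<in>J. \<exists>p. A (unit_vec R q) p \<in> carrier R - P \<and>
    (\<forall>j\<in>J. \<forall>i. A (unit_vec R q) p divides A (unit_vec R j) i)"
proof -
  let ?S = "(\<lambda>(j, i). A (unit_vec R j) i) ` (J \<times> L)"
  have entry: "A (unit_vec R j) \<in> carrier (fvec R L)" if "j \<in> J" for j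
    by (rule module_hom_closed[OF A unit_vec_closed[OF that]])
  have S: "finite ?S" "?S \<subseteq> carrier R" "\<not> ?S \<subseteq> P"
    using J L j entry by (auto simp: fvec_simps)
  from ex_common_divisor[OF this comp P] obtain q p where qp: "q \<in> J" "A (unit_vec R q) p \<notin> P"
    and dv: "\<And>j i. j \<in> J \<Longrightarrow> i \<in> L \<Longrightarrow> A (unit_vec R q) p divides A (unit_vec R j) i" by auto
  have a: "A (unit_vec R q) p \<in> carrier R" using entry[OF qp(1)] by (simp add: fvec_simps)
  have "A (unit_vec R q) p divides A (unit_vec R j) i" if "j \<in> J" for j i
    using dv[OF that, of i] entry[OF that] a by (cases "i \<in> L") (auto simp: fvec_simps divides_zero)
  then show ?thesis using qp a by blast
qed

lemma splitting_chain_ring: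
  assumes loc: "local_ring R"
    and chain: "\<And>a b. a \<in> carrier R \<Longrightarrow> b \<in> carrier R \<Longrightarrow> a divides b \<or> b divides a"
    and J: "finite J" "J \<noteq> {}" and L: "finite L" and A: "A \<in> module_hom R (fvec R J) (fvec R L)"
  shows "\<exists>q I. splitting J (fvec R L) A q I \<and>
    (fin_gen R (ideal_module R I) \<longrightarrow> fin_pres (ideal_module R I))"
proof (cases "L = {}")
  case True
  obtain q where q: "q \<in> J" using J by blast
  have "A (unit_vec R q) = \<zero>\<^bsub>fvec R L\<^esub>"
    using module_hom_closed[OF A unit_vec_closed[OF q]] True by (auto simp: fvec_simps)
  then have "splitting J (fvec R L) A q (carrier R)"
    using unit_vec_closed[OF q]
    by (intro splitting_kernel_vector[OF module_fvec q]) (auto simp: unit_vec_def)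
  then show ?thesis using fin_pres_reg_module by blast
next
  case False
  then obtain j i where "j \<in> J" "i \<in> L" using J by blast
  from ex_pivot[OF J(1) L A this, of "{}"] chain obtain q p where q: "q \<in> J"
    and a: "A (unit_vec R q) p \<in> carrier R"
    and dv: "\<And>j i. j \<in> J \<Longrightarrow> A (unit_vec R q) p divides A (unit_vec R j) i" by auto
  from splitting_pivot[OF J(1) A q dv] fin_pres_annihilator_chain_ring[OF loc chain a]
  show ?thesis by blast
qed

text \<open>An entry outside \<open>P\<close> gives a pivot, which is regular, and splits off the zero ideal. If all
  entries lie in \<open>P\<close> and some kernel vector has a coordinate outside \<open>P\<close>, then dividing this vector by
  a coordinate outside \<open>P\<close> that divides all the others leaves a kernel vector with a coordinate \<open>1\<close>,
  which spans a free summand. Otherwise all entries and all kernel vectors are over \<open>P\<close>, and since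
  \<open>P\<^sup>2 = 0\<close> the ideal \<open>P\<close> splits off.\<close>

lemma splitting_sq_zero_divisible:
  assumes sz: "sq_zero_divisible P"
    and J: "finite J" "J \<noteq> {}" and L: "finite L" and A: "A \<in> module_hom R (fvec R J) (fvec R L)"
  shows "\<exists>q I. splitting J (fvec R L) A q I \<and>
    (fin_gen R (ideal_module R I) \<longrightarrow> fin_pres (ideal_module R I))"
proof -
  have P: "ideal P R" and sq: "\<And>x y. x \<in> P \<Longrightarrow> y \<in> P \<Longrightarrow> x \<otimes> y = \<zero>"
    and reg: "\<And>c z. c \<in> carrier R - P \<Longrightarrow> z \<in> carrier R \<Longrightarrow> c \<otimes> z = \<zero> \<Longrightarrow> z = \<zero>"
    and dvd: "\<And>c z. c \<in> carrier R - P \<Longrightarrow> z \<in> P \<Longrightarrow> c divides z"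
    and comp: "\<And>c z. c \<in> carrier R - P \<Longrightarrow> z \<in> carrier R \<Longrightarrow> c divides z \<or> z divides c"
    using sz unfolding sq_zero_divisible_def by blast+
  interpret P: ideal P R by (rule P)
  have entry: "A c \<in> carrier (fvec R L)" if "c \<in> carrier (fvec R J)" for c
    by (rule module_hom_closed[OF A that])
  consider (pivot) j i where "j \<in> J" "i \<in> L" "A (unit_vec R j) i \<notin> P"
    | (vector) b where "b \<in> carrier (fvec R J)" "A b = \<zero>\<^bsub>fvec R L\<^esub>" "\<exists>q. b q \<notin> P"
    | (torsion) "\<And>j i. j \<in> J \<Longrightarrow> i \<in> L \<Longrightarrow> A (unit_vec R j) i \<in> P"
        "\<And>c q. c \<in> carrier (fvec R J) \<Longrightarrow> A c = \<zero>\<^bsub>fvec R L\<^esub> \<Longrightarrow> c q \<in> P"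
    by blast
  then show ?thesis
  proof cases
    case (pivot j i)
    from ex_pivot[OF J(1) L A pivot comp dvd] obtain q p where q: "q \<in> J"
      and a: "A (unit_vec R q) p \<in> carrier R - P"
      and dv: "\<And>j i. j \<in> J \<Longrightarrow> A (unit_vec R q) p divides A (unit_vec R j) i" by blast
    have "annihilator (A (unit_vec R q) p) = {\<zero>}"
      using reg[OF a] a by (auto simp: annihilator_def m_comm)
    then show ?thesis using splitting_pivot[OF J(1) A q dv] fin_pres_zero_ideal by fastforce
  next
    case (vector b)
    have bc: "b i \<in> carrier R" "i \<notin> J \<Longrightarrow> b i = \<zero>" for i using vector(1) by (auto simp: fvec_simps)
    have "\<not> b ` J \<subseteq> P" using vector(3) bc(2) P.zero_closed by (metis image_subset_iff)
    moreover have "finite (b ` J)" "b ` J \<subseteq> carrier R" using J(1) bc(1) by auto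
    ultimately have "\<exists>m\<in>b ` J - P. \<forall>x\<in>b ` J. m divides x"
      by (intro ex_common_divisor comp dvd)
    then obtain q where q: "q \<in> J" "b q \<notin> P" and dv: "\<And>j. j \<in> J \<Longrightarrow> b q divides b j" by auto
    have bq: "b q \<in> carrier R - P" using q bc by blast
    have "\<exists>t. t \<in> carrier R \<and> b j = b q \<otimes> t" if "j \<in> J" for j
      using dv[OF that] by (auto elim: dividesE)
    then obtain t where t: "\<And>j. j \<in> J \<Longrightarrow> t j \<in> carrier R \<and> b j = b q \<otimes> t j" by metis
    define g where "g = (\<lambda>j. if j = q then \<one> else if j \<in> J then t j else \<zero>)"
    have g: "g \<in> carrier (fvec R J)" "g q = \<one>" using t q(1) by (auto simp: g_def fvec_simps)
    have "b = b q \<odot>\<^bsub>fvec R J\<^esub> g" 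
    proof
      fix i
      show "b i = (b q \<odot>\<^bsub>fvec R J\<^esub> g) i"
        using t[of i] bc[of i] bc(1)[of q] by (cases "i = q"; cases "i \<in> J") (simp_all add: fvec_simps(4) g_def)
    qed
    then have "b q \<odot>\<^bsub>fvec R L\<^esub> A g = \<zero>\<^bsub>fvec R L\<^esub>"
      using module_hom_smult[OF A bc(1) g(1)] vector(2) by metis
    then have "b q \<otimes> A g i = \<zero>" for i by (metis fvec_simps(2,4))
    then have "A g i = \<zero>" for i using reg[OF bq] entry[OF g(1)] by (simp add: fvec_simps)
    then have "A g = \<zero>\<^bsub>fvec R L\<^esub>" by (auto simp: fvec_simps)
    from splitting_kernel_vector[where A = A and W = "fvec R L", OF module_fvec q(1) g this] fin_pres_reg_module
    show ?thesis by blast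
  next
    case torsion
    obtain q where q: "q \<in> J" using J by blast
    have e: "A (unit_vec R q) i \<in> P" for i
      using torsion(1)[OF q] entry[OF unit_vec_closed[OF q]] P.zero_closed
      by (cases "i \<in> L") (auto simp: fvec_simps)
    have "splitting J (fvec R L) A q P"
      using torsion(2) by (intro splitting_annihilated[OF q P]) (auto simp: fvec_simps sq[OF _ e])
    then show ?thesis using fin_pres_sq_zero_divisible[OF sz] by blast
  qed
qed

theorem local_fqp_kernel_fin_pres:
  assumes loc: "local_ring R" and fqp: "fqp_ring R" and J: "finite J" and L: "finite L"
    and A: "A \<in> module_hom R (fvec R J) (fvec R L)"
    and fg: "fin_gen R (ker_module (fvec R J) (fvec R L) A)"
  shows "fin_pres (ker_module (fvec R J) (fvec R L) A)"
proof (rule kernel_fin_pres_induct[OF module_fvec _ J A fg])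
  fix J and A :: "(nat \<Rightarrow> 'a) \<Rightarrow> nat \<Rightarrow> 'a"
  assume J: "finite J" "J \<noteq> {}" and A: "A \<in> module_hom R (fvec R J) (fvec R L)"
  from local_fqp_cases[OF loc fqp] show "\<exists>q I. splitting J (fvec R L) A q I \<and>
    (fin_gen R (ideal_module R I) \<longrightarrow> fin_pres (ideal_module R I))"
  proof
    assume "\<forall>a\<in>carrier R. \<forall>b\<in>carrier R. a divides b \<or> b divides a"
    then show ?thesis using splitting_chain_ring[OF loc _ J L A] by blast
  next
    assume "\<exists>P. sq_zero_divisible P"
    then obtain P where "sq_zero_divisible P" ..
    then show ?thesis using splitting_sq_zero_divisible[OF _ J L A] by blast
  qed
qed

section \<open>From finite presentations to infinite resolutions\<close>

text \<open>In the zero ring the unit vectors would coincide, hence the assumption.\<close>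

lemma free_fvec:
  assumes nontriv: "\<one> \<noteq> \<zero>" and J: "finite J"
  shows "free_module_of_finite_rank R (fvec R J)"
proof -
  let ?F = "fvec R J" and ?e = "unit_vec R"
  interpret F: module R ?F by (rule module_fvec)
  have inj: "inj_on ?e J"
    using nontriv by (auto simp: inj_on_def unit_vec_def fun_eq_iff split: if_splits)
  have eJ: "?e \<in> J \<rightarrow> carrier ?F" using unit_vec_closed by blast
  have L_id: "lincomb J ?F ?e c = c" if c: "c \<in> carrier ?F" for c
    using lincomb_unit_vec[OF module_fvec J eJ]
    by (intro fvec_hom_eqI[OF J module_fvec lincomb_hom[OF module_fvec J eJ] _ _ c] module_homI) auto
  define d where "d = (\<lambda>c j. if j \<in> J then c (?e j) else \<zero>)"
  have dF: "d c \<in> carrier ?F" if "c \<in> ?e ` J \<rightarrow>\<^sub>E carrier R" for c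
    using that by (auto simp: d_def fvec_simps)
  have sum: "(\<Oplus>\<^bsub>?F\<^esub>b\<in>?e ` J. c b \<odot>\<^bsub>?F\<^esub> b) = d c" if c: "c \<in> ?e ` J \<rightarrow>\<^sub>E carrier R" for c
  proof -
    have "(\<Oplus>\<^bsub>?F\<^esub>b\<in>?e ` J. c b \<odot>\<^bsub>?F\<^esub> b) = (\<Oplus>\<^bsub>?F\<^esub>j\<in>J. c (?e j) \<odot>\<^bsub>?F\<^esub> ?e j)"
      using c eJ by (intro F.finsum_reindex[OF _ inj]) (auto simp: PiE_iff)
    also have "\<dots> = lincomb J ?F ?e (d c)"
      unfolding lincomb_def using c eJ by (intro F.finsum_cong') (auto simp: d_def PiE_iff)
    finally show ?thesis using L_id[OF dF[OF c]] by simp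
  qed
  have "\<exists>!c. c \<in> ?e ` J \<rightarrow>\<^sub>E carrier R \<and> v = (\<Oplus>\<^bsub>?F\<^esub>b\<in>?e ` J. c b \<odot>\<^bsub>?F\<^esub> b)"
    if v: "v \<in> carrier ?F" for v
  proof (rule ex1I)
    let ?c = "restrict (\<lambda>b. v (inv_into J ?e b)) (?e ` J)"
    have c: "?c \<in> ?e ` J \<rightarrow>\<^sub>E carrier R" using v by (auto simp: fvec_simps)
    have "d ?c = v" using v inj by (auto simp: d_def fvec_simps)
    then show "?c \<in> ?e ` J \<rightarrow>\<^sub>E carrier R \<and> v = (\<Oplus>\<^bsub>?F\<^esub>b\<in>?e ` J. ?c b \<odot>\<^bsub>?F\<^esub> b)"
      using c sum[OF c] by simp
    fix c' assume c': "c' \<in> ?e ` J \<rightarrow>\<^sub>E carrier R \<and> v = (\<Oplus>\<^bsub>?F\<^esub>b\<in>?e ` J. c' b \<odot>\<^bsub>?F\<^esub> b)"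
    then have "v = d c'" using sum by simp
    then have "c' (?e j) = v j" if "j \<in> J" for j using that by (simp add: d_def)
    then show "c' = ?c" using c' c inj by (intro PiE_ext[of c' "?e ` J" "\<lambda>_. carrier R"]) auto
  qed
  then show ?thesis
    unfolding free_module_of_finite_rank_def using module_fvec J eJ
    by (intro conjI exI[of _ "?e ` J"]) auto
qed

lemma free_module_coordinates:
  assumes free: "free_module_of_finite_rank R M"
  shows "\<exists>J f. finite J \<and> f \<in> module_hom R (fvec R J) M \<and> bij_betw f (carrier (fvec R J)) (carrier M)"
proof -
  have M: "module R M" using free by (simp add: free_module_of_finite_rank_def)
  interpret M: module R M by (rule M)
  from free[unfolded free_module_of_finite_rank_def, THEN conjunct2]
  obtain B where basis: "finite B \<and> B \<subseteq> carrier M \<and> (\<forall>v\<in>carrier M.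
      \<exists>!c. c \<in> B \<rightarrow>\<^sub>E carrier R \<and> v = (\<Oplus>\<^bsub>M\<^esub>b\<in>B. c b \<odot>\<^bsub>M\<^esub> b))" ..
  then have B: "finite B" "B \<subseteq> carrier M" by simp_all
  have ex1: "\<exists>!c. c \<in> B \<rightarrow>\<^sub>E carrier R \<and> v = (\<Oplus>\<^bsub>M\<^esub>b\<in>B. c b \<odot>\<^bsub>M\<^esub> b)"
    if "v \<in> carrier M" for v
    using basis that by simp
  obtain h where "bij_betw h {0..<card B} B" using ex_bij_betw_nat_finite[OF B(1)] by blast
  then obtain J where J: "finite J" and inj: "inj_on h J" and hB: "h ` J = B"
    by (auto simp: bij_betw_def)
  have hJ: "h \<in> J \<rightarrow> carrier M" using hB B by blast
  note L = lincomb_hom[OF M J hJ]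
  let ?L = "lincomb J M h"
  define r where "r = (\<lambda>c :: nat \<Rightarrow> 'a. restrict (\<lambda>b. c (inv_into J h b)) B)"
  have r: "r c \<in> B \<rightarrow>\<^sub>E carrier R" if "c \<in> carrier (fvec R J)" for c
    using that by (auto simp: r_def fvec_simps)
  have rh: "r c (h j) = c j" if "j \<in> J" for c j using that inj hB by (auto simp: r_def)
  have L_sum: "?L c = (\<Oplus>\<^bsub>M\<^esub>b\<in>B. c' b \<odot>\<^bsub>M\<^esub> b)"
    if c': "c' \<in> B \<rightarrow>\<^sub>E carrier R" and c: "\<And>j. j \<in> J \<Longrightarrow> c j = c' (h j)" for c c'
  proof -
    have "(\<Oplus>\<^bsub>M\<^esub>b\<in>h ` J. c' b \<odot>\<^bsub>M\<^esub> b) = (\<Oplus>\<^bsub>M\<^esub>j\<in>J. c' (h j) \<odot>\<^bsub>M\<^esub> h j)"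
      using c' hJ hB by (intro M.finsum_reindex[OF _ inj]) (auto simp: PiE_iff)
    also have "\<dots> = ?L c"
      unfolding lincomb_def using c' c hJ hB by (intro M.finsum_cong') (auto simp: PiE_iff)
    finally show ?thesis by (simp add: hB)
  qed
  have "inj_on ?L (carrier (fvec R J))"
  proof (rule inj_onI)
    fix c d assume c: "c \<in> carrier (fvec R J)" and d: "d \<in> carrier (fvec R J)" and eq: "?L c = ?L d"
    have "r c = r d"
      using ex1[OF module_hom_closed[OF L c]] r[OF c] r[OF d] L_sum[OF r[OF c], of c] L_sum[OF r[OF d], of d] rh eq
      by metis
    then have "c j = d j" if "j \<in> J" for j using rh[OF that] by metis
    then show "c = d" using c d unfolding fvec_simps fun_eq_iff by metis
  qed
  moreover have "?L ` carrier (fvec R J) = carrier M"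
  proof
    show "?L ` carrier (fvec R J) \<subseteq> carrier M" using module_hom_closed[OF L] by blast
    show "carrier M \<subseteq> ?L ` carrier (fvec R J)"
    proof
      fix v assume "v \<in> carrier M"
      then obtain c where c: "c \<in> B \<rightarrow>\<^sub>E carrier R" "v = (\<Oplus>\<^bsub>M\<^esub>b\<in>B. c b \<odot>\<^bsub>M\<^esub> b)"
        using ex1 by blast
      let ?d = "\<lambda>j. if j \<in> J then c (h j) else \<zero>"
      have "?d \<in> carrier (fvec R J)" using c(1) hB by (auto simp: fvec_simps)
      moreover have "v = ?L ?d" using L_sum[OF c(1), of ?d] c(2) by simp
      ultimately show "v \<in> ?L ` carrier (fvec R J)" by (rule rev_image_eqI[where f = ?L])
    qed
  qed
  ultimately show ?thesis using J L by (auto simp: bij_betw_def)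
qed

lemma module_hom_inv_into:
  assumes V: "module R V" and f: "f \<in> module_hom R V W" and bij: "bij_betw f (carrier V) (carrier W)"
  shows "inv_into (carrier V) f \<in> module_hom R W V"
proof -
  interpret V: module R V by (rule V)
  let ?g = "inv_into (carrier V) f"
  have inj: "inj_on f (carrier V)" and im: "f ` carrier V = carrier W"
    using bij by (auto simp: bij_betw_def)
  have g: "?g w \<in> carrier V" "f (?g w) = w" if "w \<in> carrier W" for w
    using that im by (auto simp: inv_into_into f_inv_into_f)
  show ?thesis
  proof (rule module_homI)
    fix x y assume "x \<in> carrier W" "y \<in> carrier W"
    then have "x \<oplus>\<^bsub>W\<^esub> y = f (?g x \<oplus>\<^bsub>V\<^esub> ?g y)" using g module_hom_add[OF f] by simp
    then show "?g (x \<oplus>\<^bsub>W\<^esub> y) = ?g x \<oplus>\<^bsub>V\<^esub> ?g y"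
      using inv_into_f_f[OF inj] V.a_closed g \<open>x \<in> _\<close> \<open>y \<in> _\<close> by simp
  next
    fix r x assume "r \<in> carrier R" "x \<in> carrier W"
    then have "r \<odot>\<^bsub>W\<^esub> x = f (r \<odot>\<^bsub>V\<^esub> ?g x)" using g module_hom_smult[OF f] by simp
    then show "?g (r \<odot>\<^bsub>W\<^esub> x) = r \<odot>\<^bsub>V\<^esub> ?g x"
      using inv_into_f_f[OF inj] g \<open>r \<in> _\<close> \<open>x \<in> _\<close> by simp
  qed (rule g)
qed

text \<open>Each differential has a finitely generated kernel, so the kernel is finitely presented, and a
  presentation of it provides the next differential, whose kernel is again finitely generated.
  The states of the dependent choice are triples of domain, codomain and map.\<close>

lemma local_fqp_resolution:
  assumes loc: "local_ring R" and fqp: "fqp_ring R"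
    and J0: "finite J0" and J1: "finite J1" and A: "A \<in> module_hom R (fvec R J1) (fvec R J0)"
    and fg: "fin_gen R (ker_module (fvec R J1) (fvec R J0) A)"
  shows "\<exists>J D. J 0 = J0 \<and> D 0 = A \<and> J 1 = J1 \<and> (\<forall>i. finite (J i)) \<and>
    (\<forall>i. D i \<in> module_hom R (fvec R (J (Suc i))) (fvec R (J i))) \<and>
    (\<forall>i. D (Suc i) ` carrier (fvec R (J (Suc (Suc i)))) =
      a_kernel (fvec R (J (Suc i))) (fvec R (J i)) (D i))"
proof -
  define good where "good = (\<lambda>(J, L, A). finite J \<and> finite L \<and>
    A \<in> module_hom R (fvec R J) (fvec R L) \<and> fin_gen R (ker_module (fvec R J) (fvec R L) A))"
  define next_step where "next_step = (\<lambda>(J, L, A) (J', L', A'). L' = J \<and>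
    A' ` carrier (fvec R J') = a_kernel (fvec R J) (fvec R L) A)"
  have step: "\<exists>t'. good t' \<and> next_step t t'" if t: "good t" for t
  proof -
    obtain J L A where tt: "t = (J, L, A)" by (cases t)
    from t have h: "finite J" "finite L" "A \<in> module_hom R (fvec R J) (fvec R L)"
      "fin_gen R (ker_module (fvec R J) (fvec R L) A)" by (auto simp: good_def tt)
    let ?K = "ker_module (fvec R J) (fvec R L) A"
    from local_fqp_kernel_fin_pres[OF loc fqp h] obtain J' p where J': "finite J'"
      and p: "p \<in> module_hom R (fvec R J') ?K" "p ` carrier (fvec R J') = carrier ?K"
      and fg': "fin_gen R (ker_module (fvec R J') ?K p)"
      unfolding fin_pres_def by blast
    have "p \<in> module_hom R (fvec R J') (fvec R J)"
      using p(1) by (auto simp: module_hom_def a_kernel_def')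
    moreover have "a_kernel (fvec R J') ?K p = a_kernel (fvec R J') (fvec R J) p"
      by (simp add: a_kernel_def')
    ultimately have "good (J', J, p)" using J' h(1) fg' by (simp add: good_def)
    moreover have "next_step t (J', J, p)" using p(2) by (simp add: next_step_def tt)
    ultimately show ?thesis by blast
  qed
  have "good (J1, J0, A)" using J0 J1 A fg by (simp add: good_def)
  then have "\<exists>t. \<forall>n. (good (t n) \<and> (n = 0 \<longrightarrow> t n = (J1, J0, A))) \<and> next_step (t n) (t (Suc n))"
    using step by (intro dependent_nat_choice) blast+
  then obtain t where t: "\<And>n. good (t n)" "t 0 = (J1, J0, A)" "\<And>n. next_step (t n) (t (Suc n))"
    by blast
  define J where "J = (\<lambda>i. case i of 0 \<Rightarrow> J0 | Suc k \<Rightarrow> fst (t k))"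
  define D where "D = (\<lambda>i. snd (snd (t i)))"
  have cod: "fst (snd (t i)) = J i" for i
    using t(2) t(3)[of "i - 1"]
    by (cases i) (auto simp: J_def next_step_def split: prod.splits)
  have tJ: "t i = (J (Suc i), J i, D i)" for i
    using cod[of i] by (auto simp: J_def D_def prod_eq_iff)
  have "finite (J i)" "D i \<in> module_hom R (fvec R (J (Suc i))) (fvec R (J i))" for i
    using t(1)[of i] by (auto simp: tJ good_def)
  moreover have "D (Suc i) ` carrier (fvec R (J (Suc (Suc i)))) =
      a_kernel (fvec R (J (Suc i))) (fvec R (J i)) (D i)" for i
    using t(3)[of i] by (auto simp: tJ next_step_def)
  moreover have "J 0 = J0" "J 1 = J1" "D 0 = A" using t(2) by (simp_all add: J_def D_def)
  ultimately show ?thesis by blast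
qed

lemma local_ring_nontrivial:
  assumes "local_ring R"
  shows "\<one> \<noteq> \<zero>"
proof
  assume "\<one> = \<zero>"
  then have "\<zero> \<in> Units R" using Units_one_closed by simp
  moreover have "\<zero> \<in> carrier R - Units R"
    using additive_subgroup.zero_closed[OF ideal.axioms(1)[OF local_ring_nonunits[OF assms]]] .
  ultimately show False by blast
qed

text \<open>The first map of the presentation is written as a matrix \<open>A\<close> in bases of \<open>F\<^sub>1\<close> and \<open>F\<^sub>0\<close>. The
  kernel of \<open>A\<close> is finitely generated because it is the image of \<open>F\<^sub>2\<close>; from there on the
  presentation is replaced by a resolution of arbitrary length.\<close>

lemma local_fqp_extend_presentation:
  assumes loc: "local_ring R" and fqp: "fqp_ring R" and E: "module R E"
    and pres: "finite_n_presentation R n E F d e" and n: "2 \<le> n"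
  shows "\<exists>F d e. finite_n_presentation R m E F d e"
proof -
  have free: "free_module_of_finite_rank R (F 0)" "free_module_of_finite_rank R (F 1)"
      "free_module_of_finite_rank R (F 2)"
    and d0: "d 0 \<in> module_hom R (F 1) (F 0)" and d1: "d 1 \<in> module_hom R (F 2) (F 1)"
    and e: "e \<in> module_hom R (F 0) E" and e_surj: "e ` carrier (F 0) = carrier E"
    and ex0: "d 0 ` carrier (F 1) = a_kernel (F 0) E e"
    and ex1: "d 1 ` carrier (F 2) = a_kernel (F 1) (F 0) (d 0)"
    using pres n unfolding finite_n_presentation_def by (auto simp: numeral_2_eq_2)
  have F0: "module R (F 0)" and F1: "module R (F 1)"
    using free by (auto simp: free_module_of_finite_rank_def)
  obtain J0 f0 where J0: "finite J0" and f0: "f0 \<in> module_hom R (fvec R J0) (F 0)"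
    and b0: "bij_betw f0 (carrier (fvec R J0)) (carrier (F 0))"
    using free_module_coordinates[OF free(1)] by blast
  obtain J1 f1 where J1: "finite J1" and f1: "f1 \<in> module_hom R (fvec R J1) (F 1)"
    and b1: "bij_betw f1 (carrier (fvec R J1)) (carrier (F 1))"
    using free_module_coordinates[OF free(2)] by blast
  obtain J2 f2 where J2: "finite J2" and f2: "f2 \<in> module_hom R (fvec R J2) (F 2)"
    and b2: "bij_betw f2 (carrier (fvec R J2)) (carrier (F 2))"
    using free_module_coordinates[OF free(3)] by blast
  define g0 where "g0 = inv_into (carrier (fvec R J0)) f0"
  define g1 where "g1 = inv_into (carrier (fvec R J1)) f1"
  have g0: "g0 \<in> module_hom R (F 0) (fvec R J0)"
    unfolding g0_def by (rule module_hom_inv_into[OF module_fvec f0 b0])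
  have g1: "g1 \<in> module_hom R (F 1) (fvec R J1)"
    unfolding g1_def by (rule module_hom_inv_into[OF module_fvec f1 b1])
  have gf0: "g0 (f0 c) = c" if "c \<in> carrier (fvec R J0)" for c
    unfolding g0_def using b0 that by (auto simp: bij_betw_def)
  have fg0: "f0 (g0 x) = x" if "x \<in> carrier (F 0)" for x
    unfolding g0_def using b0 that by (auto simp: bij_betw_def f_inv_into_f)
  have gf1: "g1 (f1 c) = c" if "c \<in> carrier (fvec R J1)" for c
    unfolding g1_def using b1 that by (auto simp: bij_betw_def)
  have fg1: "f1 (g1 x) = x" if "x \<in> carrier (F 1)" for x
    unfolding g1_def using b1 that by (auto simp: bij_betw_def f_inv_into_f)
  note cl = module_hom_closed[OF f0] module_hom_closed[OF f1] module_hom_closed[OF g0]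
    module_hom_closed[OF g1] module_hom_closed[OF d0]
  have im0: "f0 ` carrier (fvec R J0) = carrier (F 0)" and im1: "f1 ` carrier (fvec R J1) = carrier (F 1)"
    and im2: "f2 ` carrier (fvec R J2) = carrier (F 2)" using b0 b1 b2 by (auto simp: bij_betw_def)
  define A where "A = (\<lambda>c. g0 (d 0 (f1 c)))"
  have A: "A \<in> module_hom R (fvec R J1) (fvec R J0)"
    unfolding A_def by (intro module_hom_comp[OF _ g0] module_hom_comp[OF f1 d0])
  have fA: "f0 (A c) = d 0 (f1 c)" if "c \<in> carrier (fvec R J1)" for c
    unfolding A_def using fg0 cl that by simp
  have A0: "A c = \<zero>\<^bsub>fvec R J0\<^esub> \<longleftrightarrow> d 0 (f1 c) = \<zero>\<^bsub>F 0\<^esub>" if c: "c \<in> carrier (fvec R J1)" for c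
    using fA[OF c] module_hom_zero[OF module_fvec F0 f0] module_hom_zero[OF F0 module_fvec g0]
    by (metis A_def)
  have kerA: "a_kernel (fvec R J1) (fvec R J0) A = g1 ` a_kernel (F 1) (F 0) (d 0)"
  proof
    show "a_kernel (fvec R J1) (fvec R J0) A \<subseteq> g1 ` a_kernel (F 1) (F 0) (d 0)"
    proof
      fix c assume "c \<in> a_kernel (fvec R J1) (fvec R J0) A"
      then have c: "c \<in> carrier (fvec R J1)" "d 0 (f1 c) = \<zero>\<^bsub>F 0\<^esub>" using A0 by (auto simp: a_kernel_def')
      then have "f1 c \<in> a_kernel (F 1) (F 0) (d 0)" using cl by (simp add: a_kernel_def')
      with gf1[OF c(1)] show "c \<in> g1 ` a_kernel (F 1) (F 0) (d 0)" by (metis imageI)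
    qed
    show "g1 ` a_kernel (F 1) (F 0) (d 0) \<subseteq> a_kernel (fvec R J1) (fvec R J0) A"
      using A0 cl fg1 by (auto simp: a_kernel_def')
  qed
  have "fin_gen R (ker_module (fvec R J1) (fvec R J0) A)"
  proof (rule fin_gen_image[OF module_fvec module_ker_module[OF module_fvec module_fvec A] _ _ fin_gen_fvec[OF J2]])
    let ?h = "\<lambda>c. g1 (d 1 (f2 c))"
    show im: "?h ` carrier (fvec R J2) = carrier (ker_module (fvec R J1) (fvec R J0) A)"
    proof -
      have "?h ` carrier (fvec R J2) = g1 ` d 1 ` f2 ` carrier (fvec R J2)" by (simp only: image_image)
      then show ?thesis unfolding im2 ex1 by (simp add: kerA)
    qed
    have h: "?h \<in> module_hom R (fvec R J2) (fvec R J1)"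
      by (intro module_hom_comp[OF _ g1] module_hom_comp[OF f2 d1])
    show "?h \<in> module_hom R (fvec R J2) (ker_module (fvec R J1) (fvec R J0) A)"
      using im by (intro module_homI) (auto simp: module_hom_add[OF h] module_hom_smult[OF h] simp del: One_nat_def)
  qed
  from local_fqp_resolution[OF loc fqp J0 J1 A this] obtain J D where
    JD: "J 0 = J0 \<and> D 0 = A \<and> J 1 = J1 \<and> (\<forall>i. finite (J i)) \<and>
      (\<forall>i. D i \<in> module_hom R (fvec R (J (Suc i))) (fvec R (J i))) \<and>
      (\<forall>i. D (Suc i) ` carrier (fvec R (J (Suc (Suc i)))) =
        a_kernel (fvec R (J (Suc i))) (fvec R (J i)) (D i))"
    by (elim exE) (rule that)
  have J: "J 0 = J0" "J 1 = J1" "\<And>i. finite (J i)" and D0: "D 0 = A"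
    and D: "\<And>i. D i \<in> module_hom R (fvec R (J (Suc i))) (fvec R (J i))"
    and exD: "\<And>i. D (Suc i) ` carrier (fvec R (J (Suc (Suc i)))) =
      a_kernel (fvec R (J (Suc i))) (fvec R (J i)) (D i)"
    using JD by metis+
  let ?e = "\<lambda>c. e (f0 c)"
  have e': "?e \<in> module_hom R (fvec R (J 0)) E" unfolding J by (rule module_hom_comp[OF f0 e])
  have surj: "?e ` carrier (fvec R (J 0)) = carrier E"
    using e_surj im0 by (simp add: J image_image[symmetric])
  have ex: "D 0 ` carrier (fvec R (J 1)) = a_kernel (fvec R (J 0)) E ?e"
  proof -
    have "A ` carrier (fvec R J1) = g0 ` d 0 ` f1 ` carrier (fvec R J1)"
      by (simp only: A_def image_image)
    also have "\<dots> = g0 ` a_kernel (F 0) E e" unfolding im1 ex0 ..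
    also have "\<dots> = a_kernel (fvec R J0) E ?e"
    proof
      show "g0 ` a_kernel (F 0) E e \<subseteq> a_kernel (fvec R J0) E ?e"
        using cl fg0 by (auto simp: a_kernel_def')
      show "a_kernel (fvec R J0) E ?e \<subseteq> g0 ` a_kernel (F 0) E e"
      proof
        fix c assume "c \<in> a_kernel (fvec R J0) E ?e"
        then have c: "c \<in> carrier (fvec R J0)" "f0 c \<in> a_kernel (F 0) E e"
          using cl by (auto simp: a_kernel_def')
        with gf0[OF c(1)] show "c \<in> g0 ` a_kernel (F 0) E e" by (metis imageI)
      qed
    qed
    finally show ?thesis by (simp only: J D0)
  qed
  have "finite_n_presentation R m E (\<lambda>i. fvec R (J i)) D ?e"
    unfolding finite_n_presentation_def
  proof (intro conjI allI impI)
    show "free_module_of_finite_rank R (fvec R (J i))" for i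
      by (rule free_fvec[OF local_ring_nontrivial[OF loc] J(3)])
  qed (use D e' surj ex exD in auto)
  then show ?thesis by blast
qed

end

theorem theorem4p1:
  fixes R :: "('a, 'r) ring_scheme"
  assumes "local_ring R"
    and "fqp_ring R"
  shows "lambda_dim TYPE('m) R \<le> 2"
proof -
  interpret cring R using assms(1) by (simp add: local_ring_def)
  have "pres_length R E = \<infinity>" if E: "module R E" and le: "ereal (real 2) \<le> pres_length R E"
    for E :: "('a, 'm) module"
  proof -
    let ?S = "{ereal (real n) | n. \<exists>F d e. finite_n_presentation R n E F d e}"
    have fg: "fg_module R E"
    proof (rule ccontr)
      assume "\<not> fg_module R E"
      then have "pres_length R E = - 1" by (simp add: pres_length_def)
      then show False using le by (simp add: one_ereal_def)
    qed
    then have pl: "pres_length R E = Sup ?S" by (simp add: pres_length_def)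
    \<comment> \<open>The supremum of a set of natural numbers below \<open>2\<close> is at most \<open>1\<close>, so some
      presentation has length at least \<open>2\<close>.\<close>
    have "\<exists>n F d e. finite_n_presentation R n E F d e \<and> 2 \<le> n"
    proof (rule ccontr)
      assume no: "\<nexists>n F d e. finite_n_presentation R n E F d e \<and> 2 \<le> n"
      have "Sup ?S \<le> ereal 1"
      proof (rule Sup_least)
        fix x assume "x \<in> ?S"
        then obtain n where "x = ereal (real n)" "\<exists>F d e. finite_n_presentation R n E F d e" by blast
        moreover then have "n \<le> 1" using no by (metis not_less_eq_eq numeral_2_eq_2 One_nat_def)
        ultimately show "x \<le> ereal 1" by simp
      qed
      with le have "ereal (real 2) \<le> ereal 1" unfolding pl by (rule order_trans)
      then show False by simp
    qed
    then have all: "\<exists>F d e. finite_n_presentation R m E F d e" for m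
      using local_fqp_extend_presentation[OF assms E] by blast
    have "Sup ?S = \<infinity>"
    proof (rule ereal_top)
      fix B :: real
      obtain n where "B \<le> real n" using real_arch_simple by blast
      then have "ereal B \<le> ereal (real n)" by simp
      also have "\<dots> \<le> Sup ?S" using all by (intro Sup_upper) blast
      finally show "ereal B \<le> Sup ?S" .
    qed
    then show ?thesis unfolding pl .
  qed
  then have "lambda_dim TYPE('m) R \<le> enat 2"
    unfolding lambda_dim_def by (intro Inf_lower imageI) blast
  then show ?thesis by (simp add: numeral_eq_enat)
qed

end
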